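(* (Relative Mennicke–Newman) Let $R$ be a commutative noetherian ring and $I$ an ideal in $R$ such that $\max(R)$ is a disjoint union of $V(I)$ and finitely many irreducible closed sets $V_i$, each a noetherian topological space of dimension at most $d$. Assume $d\le 2n-3$ and $n\ge3$. Let $v,w\in\mathrm{Um}_n(R,I)$. Then there exist $\varepsilon_1,\varepsilon_2\in\mathrm{E}_n(R,I)$ such that $v\varepsilon_1=(a,a_2,a_3,\dots,a_n)$ and $w\varepsilon_2=(b,a_2,a_3,\dots,a_n)$ for some $a,b,a_2,\dots,a_n\in R$.
   Context: All rings are commutative with unity. $\max(R)$ is the maximal spectrum of $R$ with the Zariski topology, and $V(I)\subseteq\max(R)$ is the set of maximal ideals containing $I$. $\mathrm{Um}_n(R)$ is the set of rows $v\in R^n$ such that $v\cdot w^t=1$ for some $w\in R^n$. For an ideal $I$ of $R$, $\mathrm{Um}_n(R,I)$ is the set of $v\in \mathrm{Um}_n(R)$ with $v\equiv (1,0,\dots,0)$ modulo $I$. $\mathrm{E}_n(R)$ is the subgroup of $\mathrm{GL}_n(R)$ generated by the matrices $E_{ij}(\lambda)=I_n+\lambda e_{ij}$, $i\neq j$, $\lambda\in R$; $\mathrm{E}_n(R,I)$ is the smallest normal subgroup of $\mathrm{E}_n(R)$ containing all $E_{21}(x)$, $x\in I$. *)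

theory Defs
  imports
    "HOL-Algebra.Ring_Divisibility"
    "HOL-Algebra.Generated_Groups"
    "HOL-Analysis.Abstract_Topology"
    "HOL-Library.Extended_Nat"
    "HOL-Library.Disjoint_Sets"
begin

section \<open>Topological notions\<close>

definition irreducible_space :: "'a topology \<Rightarrow> bool" where
  "irreducible_space X \<longleftrightarrow>
     topspace X \<noteq> {} \<and>
     (\<forall>A B. closedin X A \<and> closedin X B \<and> topspace X = A \<union> B
        \<longrightarrow> A = topspace X \<or> B = topspace X)"

definition noetherian_space :: "'a topology \<Rightarrow> bool" where
  "noetherian_space X \<longleftrightarrow>
     (\<forall>C :: nat \<Rightarrow> 'a set. (\<forall>i. closedin X (C i)) \<and> (\<forall>i. C (Suc i) \<subseteq> C i)
        \<longrightarrow> (\<exists>N. \<forall>i\<ge>N. C i = C N))"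

text \<open>
  The supremum of the lengths \<open>k\<close> of the chains \<open>Z 0 \<subset> \<dots> \<subset> Z k\<close> of irreducible closed
  subsets.  The empty space gets dimension 0 here; a nonempty space has dimension at least 0
  under any convention.
\<close>

definition top_dim :: "'a topology \<Rightarrow> enat" where
  "top_dim X =
     Sup {enat k | k. \<exists>Z :: nat \<Rightarrow> 'a set.
       (\<forall>i\<le>k. closedin X (Z i) \<and> irreducible_space (subtopology X (Z i))) \<and>
       (\<forall>i<k. Z i \<subset> Z (Suc i))}"


section \<open>The maximal spectrum\<close>

definition max_spec :: "('a, 'b) ring_scheme \<Rightarrow> 'a set set" where
  "max_spec R = {M. maximalideal M R}"

definition V_max :: "('a, 'b) ring_scheme \<Rightarrow> 'a set \<Rightarrow> 'a set set" where
  "V_max R J = {M \<in> max_spec R. J \<subseteq> M}"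

definition zariski :: "('a, 'b) ring_scheme \<Rightarrow> 'a set topology" where
  "zariski R = topology (\<lambda>U. \<exists>J. ideal J R \<and> U = max_spec R - V_max R J)"

lemma (in cring) istopology_zariski:
  "istopology (\<lambda>U. \<exists>J. ideal J R \<and> U = max_spec R - V_max R J)"
  unfolding istopology_def
proof (intro conjI allI impI)
  fix S T
  assume "\<exists>J. ideal J R \<and> S = max_spec R - V_max R J"
    and "\<exists>J. ideal J R \<and> T = max_spec R - V_max R J"
  then obtain J K where J: "ideal J R" "S = max_spec R - V_max R J"
    and K: "ideal K R" "T = max_spec R - V_max R K" by blast
  have "J \<subseteq> M \<or> K \<subseteq> M" if M: "maximalideal M R" and JK: "J \<inter> K \<subseteq> M" for M
  proof (rule ccontr)
    assume "\<not> (J \<subseteq> M \<or> K \<subseteq> M)"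
    then obtain x y where xy: "x \<in> J" "x \<notin> M" "y \<in> K" "y \<notin> M" by blast
    have xR: "x \<in> carrier R" and yR: "y \<in> carrier R"
      using xy J(1) K(1) by (auto dest: ideal.Icarr)
    have "x \<otimes> y \<in> J \<inter> K"
      using xy xR yR J(1) K(1) by (auto intro: ideal.I_r_closed ideal.I_l_closed)
    then show False
      using primeideal.I_prime[OF maximalideal_prime[OF M] xR yR] JK xy by blast
  qed
  then have "S \<inter> T = max_spec R - V_max R (J \<inter> K)"
    using J K by (auto simp: V_max_def max_spec_def)
  then show "\<exists>L. ideal L R \<and> S \<inter> T = max_spec R - V_max R L"
    using i_intersect[OF J(1) K(1)] by blast
next
  fix \<K>
  assume "\<forall>S\<in>\<K>. \<exists>J. ideal J R \<and> S = max_spec R - V_max R J"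
  then obtain J where J: "\<And>S. S \<in> \<K> \<Longrightarrow> ideal (J S) R"
    "\<And>S. S \<in> \<K> \<Longrightarrow> S = max_spec R - V_max R (J S)" by metis
  have sub: "(\<Union>S\<in>\<K>. J S) \<subseteq> carrier R"
    using J(1) by (auto dest: ideal.Icarr)
  have "M \<in> V_max R (Idl (\<Union>S\<in>\<K>. J S)) \<longleftrightarrow> (\<forall>S\<in>\<K>. J S \<subseteq> M)" if "M \<in> max_spec R" for M
  proof
    assume "M \<in> V_max R (Idl (\<Union>S\<in>\<K>. J S))"
    then show "\<forall>S\<in>\<K>. J S \<subseteq> M"
      using genideal_self[OF sub] by (auto simp: V_max_def)
  next
    assume "\<forall>S\<in>\<K>. J S \<subseteq> M"
    then show "M \<in> V_max R (Idl (\<Union>S\<in>\<K>. J S))"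
      using genideal_minimal[of M "\<Union>S\<in>\<K>. J S"] that
      by (auto simp: V_max_def max_spec_def dest: maximalideal.axioms(1))
  qed
  moreover have "M \<in> \<Union>\<K> \<longleftrightarrow> M \<in> max_spec R \<and> \<not> (\<forall>S\<in>\<K>. J S \<subseteq> M)" for M
  proof
    assume "M \<in> \<Union>\<K>"
    then obtain S where S: "S \<in> \<K>" "M \<in> S" by blast
    then have "M \<in> max_spec R - V_max R (J S)" using J(2) by blast
    with S show "M \<in> max_spec R \<and> \<not> (\<forall>S\<in>\<K>. J S \<subseteq> M)" by (auto simp: V_max_def)
  next
    assume "M \<in> max_spec R \<and> \<not> (\<forall>S\<in>\<K>. J S \<subseteq> M)"
    then obtain S where S: "S \<in> \<K>" "M \<in> max_spec R - V_max R (J S)"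
      by (auto simp: V_max_def)
    then show "M \<in> \<Union>\<K>" using J(2) by blast
  qed
  ultimately have "\<Union>\<K> = max_spec R - V_max R (Idl (\<Union>S\<in>\<K>. J S))"
    by blast
  then show "\<exists>L. ideal L R \<and> \<Union>\<K> = max_spec R - V_max R L"
    using genideal_ideal[OF sub] by blast
qed

lemma (in cring) openin_zariski:
  "openin (zariski R) U \<longleftrightarrow> (\<exists>J. ideal J R \<and> U = max_spec R - V_max R J)"
  unfolding zariski_def using istopology_zariski by simp

lemma (in cring) topspace_zariski: "topspace (zariski R) = max_spec R"
proof -
  have "V_max R (carrier R) = {}"
    unfolding V_max_def max_spec_def
    by (auto dest: maximalideal.I_notcarr maximalideal.axioms(1) ideal.Icarr)
  then have "openin (zariski R) (max_spec R)"
    unfolding openin_zariski using oneideal by (intro exI[of _ "carrier R"]) simp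
  then show ?thesis
    by (intro antisym openin_subset) (auto simp: topspace_def openin_zariski)
qed

lemma (in cring) closedin_zariski:
  "closedin (zariski R) C \<longleftrightarrow> (\<exists>J. ideal J R \<and> C = V_max R J)"
proof -
  have "V_max R J \<subseteq> max_spec R" for J
    by (auto simp: V_max_def)
  then show ?thesis
    unfolding closedin_def topspace_zariski openin_zariski by blast
qed


section \<open>Unimodular rows\<close>

text \<open>Rows of length \<open>n\<close> and \<open>n \<times> n\<close> matrices are extensional functions on
  \<open>{1..n}\<close> and \<open>{1..n} \<times> {1..n}\<close>.\<close>

definition rows :: "('a, 'b) ring_scheme \<Rightarrow> nat \<Rightarrow> (nat \<Rightarrow> 'a) set" where
  "rows R n = {1..n} \<rightarrow>\<^sub>E carrier R"

definition Um :: "('a, 'b) ring_scheme \<Rightarrow> nat \<Rightarrow> (nat \<Rightarrow> 'a) set" where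
  "Um R n = {v \<in> rows R n. \<exists>w\<in>rows R n. (\<Oplus>\<^bsub>R\<^esub>i\<in>{1..n}. v i \<otimes>\<^bsub>R\<^esub> w i) = \<one>\<^bsub>R\<^esub>}"

definition Um_rel :: "('a, 'b) ring_scheme \<Rightarrow> nat \<Rightarrow> 'a set \<Rightarrow> (nat \<Rightarrow> 'a) set" where
  "Um_rel R n I =
     {v \<in> Um R n. \<forall>i\<in>{1..n}. v i \<ominus>\<^bsub>R\<^esub> (if i = 1 then \<one>\<^bsub>R\<^esub> else \<zero>\<^bsub>R\<^esub>) \<in> I}"


section \<open>Matrix groups\<close>

definition mat_monoid :: "('a, 'b) ring_scheme \<Rightarrow> nat \<Rightarrow> (nat \<times> nat \<Rightarrow> 'a) monoid" where
  "mat_monoid R n =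
     \<lparr>carrier = {1..n} \<times> {1..n} \<rightarrow>\<^sub>E carrier R,
      mult = (\<lambda>A B. \<lambda>(i, j)\<in>{1..n} \<times> {1..n}. \<Oplus>\<^bsub>R\<^esub>k\<in>{1..n}. A (i, k) \<otimes>\<^bsub>R\<^esub> B (k, j)),
      one = (\<lambda>(i, j)\<in>{1..n} \<times> {1..n}. if i = j then \<one>\<^bsub>R\<^esub> else \<zero>\<^bsub>R\<^esub>)\<rparr>"

definition GL :: "('a, 'b) ring_scheme \<Rightarrow> nat \<Rightarrow> (nat \<times> nat \<Rightarrow> 'a) monoid" where
  "GL R n = units_of (mat_monoid R n)"

definition elem_mat ::
    "('a, 'b) ring_scheme \<Rightarrow> nat \<Rightarrow> nat \<Rightarrow> nat \<Rightarrow> 'a \<Rightarrow> nat \<times> nat \<Rightarrow> 'a" where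
  "elem_mat R n i j x =
     (\<lambda>(k, l)\<in>{1..n} \<times> {1..n}.
        (if k = l then \<one>\<^bsub>R\<^esub> else \<zero>\<^bsub>R\<^esub>) \<oplus>\<^bsub>R\<^esub> (if k = i \<and> l = j then x else \<zero>\<^bsub>R\<^esub>))"

definition E_grp :: "('a, 'b) ring_scheme \<Rightarrow> nat \<Rightarrow> (nat \<times> nat \<Rightarrow> 'a) monoid" where
  "E_grp R n =
     (GL R n)\<lparr>carrier := generate (GL R n)
        {elem_mat R n i j x | i j x. i \<in> {1..n} \<and> j \<in> {1..n} \<and> i \<noteq> j \<and> x \<in> carrier R}\<rparr>"

definition E_rel :: "('a, 'b) ring_scheme \<Rightarrow> nat \<Rightarrow> 'a set \<Rightarrow> (nat \<times> nat \<Rightarrow> 'a) set" where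
  "E_rel R n I = \<Inter>{N. N \<lhd> E_grp R n \<and> (\<forall>x\<in>I. elem_mat R n 2 1 x \<in> N)}"

definition row_mult ::
    "('a, 'b) ring_scheme \<Rightarrow> nat \<Rightarrow> (nat \<Rightarrow> 'a) \<Rightarrow> (nat \<times> nat \<Rightarrow> 'a) \<Rightarrow> nat \<Rightarrow> 'a" where
  "row_mult R n v A = (\<lambda>j\<in>{1..n}. \<Oplus>\<^bsub>R\<^esub>i\<in>{1..n}. v i \<otimes>\<^bsub>R\<^esub> A (i, j))"

lemma (in cring) monoid_mat_monoid: "monoid (mat_monoid R n)"
proof
  let ?N = "{1..n}"
  let ?M = "mat_monoid R n"
  have cl: "A (i, j) \<in> carrier R" if "A \<in> carrier ?M" "i \<in> ?N" "j \<in> ?N" for A i j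
    using that by (auto simp: mat_monoid_def)
  show one: "\<one>\<^bsub>?M\<^esub> \<in> carrier ?M"
    by (auto simp: mat_monoid_def)
  show mult: "A \<otimes>\<^bsub>?M\<^esub> B \<in> carrier ?M" if "A \<in> carrier ?M" "B \<in> carrier ?M" for A B
    using cl[OF that(1)] cl[OF that(2)] by (auto simp: mat_monoid_def intro!: finsum_closed)
  have eqI: "A = B" if "A \<in> carrier ?M" "B \<in> carrier ?M"
    "\<And>i j. i \<in> ?N \<Longrightarrow> j \<in> ?N \<Longrightarrow> A (i, j) = B (i, j)" for A B
  proof (rule PiE_ext)
    show "A \<in> ?N \<times> ?N \<rightarrow>\<^sub>E carrier R" "B \<in> ?N \<times> ?N \<rightarrow>\<^sub>E carrier R"
      using that(1,2) by (simp_all add: mat_monoid_def)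
  qed (use that(3) in blast)
  have entry: "(A \<otimes>\<^bsub>?M\<^esub> B) (i, j) = (\<Oplus>k\<in>?N. A (i, k) \<otimes> B (k, j))"
    if "i \<in> ?N" "j \<in> ?N" for A B i j
    using that by (simp add: mat_monoid_def)
  have entry1: "\<one>\<^bsub>?M\<^esub> (i, j) = (if i = j then \<one> else \<zero>)" if "i \<in> ?N" "j \<in> ?N" for i j
    using that by (simp add: mat_monoid_def)
  show "\<one>\<^bsub>?M\<^esub> \<otimes>\<^bsub>?M\<^esub> A = A" if A: "A \<in> carrier ?M" for A
  proof (rule eqI)
    fix i j assume ij: "i \<in> ?N" "j \<in> ?N"
    have "(\<one>\<^bsub>?M\<^esub> \<otimes>\<^bsub>?M\<^esub> A) (i, j) = (\<Oplus>k\<in>?N. if i = k then A (k, j) else \<zero>)"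
      unfolding entry[OF ij] using ij cl[OF A] by (intro finsum_cong') (auto simp: entry1)
    also have "\<dots> = A (i, j)"
      using ij cl[OF A] by (intro add.finprod_singleton) auto
    finally show "(\<one>\<^bsub>?M\<^esub> \<otimes>\<^bsub>?M\<^esub> A) (i, j) = A (i, j)" .
  qed (use A one mult in auto)
  show "A \<otimes>\<^bsub>?M\<^esub> \<one>\<^bsub>?M\<^esub> = A" if A: "A \<in> carrier ?M" for A
  proof (rule eqI)
    fix i j assume ij: "i \<in> ?N" "j \<in> ?N"
    have "(A \<otimes>\<^bsub>?M\<^esub> \<one>\<^bsub>?M\<^esub>) (i, j) = (\<Oplus>k\<in>?N. if j = k then A (i, k) else \<zero>)"
      unfolding entry[OF ij] using ij cl[OF A] by (intro finsum_cong') (auto simp: entry1)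
    also have "\<dots> = A (i, j)"
      using ij cl[OF A] by (intro add.finprod_singleton) auto
    finally show "(A \<otimes>\<^bsub>?M\<^esub> \<one>\<^bsub>?M\<^esub>) (i, j) = A (i, j)" .
  qed (use A one mult in auto)
  have swap: "(\<Oplus>l\<in>T. \<Oplus>k\<in>S. f k l) = (\<Oplus>k\<in>S. \<Oplus>l\<in>T. f k l)"
    if fin: "finite S" "finite T" and f: "\<And>k l. k \<in> S \<Longrightarrow> l \<in> T \<Longrightarrow> f k l \<in> carrier R"
    for S T :: "nat set" and f
    using fin(1) f
  proof (induction S rule: finite_induct)
    case empty
    then show ?case by (simp add: finsum_zero)
  next
    case (insert x F)
    have "(\<Oplus>l\<in>T. \<Oplus>k\<in>insert x F. f k l) = (\<Oplus>l\<in>T. f x l \<oplus> (\<Oplus>k\<in>F. f k l))"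
      using insert by (intro finsum_cong') (auto intro!: finsum_insert finsum_closed a_closed)
    also have "\<dots> = (\<Oplus>l\<in>T. f x l) \<oplus> (\<Oplus>l\<in>T. \<Oplus>k\<in>F. f k l)"
      using insert by (intro finsum_addf) (auto intro!: finsum_closed)
    also have "(\<Oplus>l\<in>T. \<Oplus>k\<in>F. f k l) = (\<Oplus>k\<in>F. \<Oplus>l\<in>T. f k l)"
      using insert by auto
    finally show ?case
      using insert by (subst finsum_insert) (auto intro!: finsum_closed)
  qed
  show "A \<otimes>\<^bsub>?M\<^esub> B \<otimes>\<^bsub>?M\<^esub> C = A \<otimes>\<^bsub>?M\<^esub> (B \<otimes>\<^bsub>?M\<^esub> C)"
    if A: "A \<in> carrier ?M" and B: "B \<in> carrier ?M" and C: "C \<in> carrier ?M" for A B C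
  proof (rule eqI)
    fix i j assume ij: "i \<in> ?N" "j \<in> ?N"
    note c = cl[OF A] cl[OF B] cl[OF C]
    have "(A \<otimes>\<^bsub>?M\<^esub> B \<otimes>\<^bsub>?M\<^esub> C) (i, j)
        = (\<Oplus>l\<in>?N. \<Oplus>k\<in>?N. A (i, k) \<otimes> B (k, l) \<otimes> C (l, j))"
      unfolding entry[OF ij] using ij c
      by (intro finsum_cong') (auto simp: entry intro!: finsum_ldistr finsum_closed)
    also have "\<dots> = (\<Oplus>k\<in>?N. \<Oplus>l\<in>?N. A (i, k) \<otimes> B (k, l) \<otimes> C (l, j))"
      using ij c by (intro swap) auto
    also have "\<dots> = (A \<otimes>\<^bsub>?M\<^esub> (B \<otimes>\<^bsub>?M\<^esub> C)) (i, j)"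
      unfolding entry[OF ij] using ij c
      by (intro finsum_cong')
        (auto simp: entry finsum_rdistr m_assoc intro!: finsum_closed finsum_cong')
    finally show "(A \<otimes>\<^bsub>?M\<^esub> B \<otimes>\<^bsub>?M\<^esub> C) (i, j) = (A \<otimes>\<^bsub>?M\<^esub> (B \<otimes>\<^bsub>?M\<^esub> C)) (i, j)" .
  qed (use A B C mult in auto)
qed

end

theory Submission
  imports Defs
begin

text \<open>
  Write \<open>X\<close> for the union of the sets \<open>C i\<close>.  It is closed, so \<open>X = V(K)\<close> for an ideal \<open>K\<close>, and every
  maximal ideal contains exactly one of \<open>I\<close> and \<open>K\<close>.  Hence \<open>I + K = R\<close>, and there is \<open>e \<in> I\<close> with
  \<open>e \<equiv> 1\<close> modulo \<open>K\<close>.  Multiplying by \<open>e\<close> makes a coefficient admissible for \<open>E(R, I)\<close> without changing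
  it on \<open>X\<close>; on \<open>V(I)\<close> every row in question stays congruent to \<open>(1, 0, \<dots>, 0)\<close>.  This reduces the
  relative statement to the absolute argument over \<open>X\<close>, which has three steps.

  First, the \<open>2n - 2\<close> entries \<open>v 2, \<dots>, v n, w 2, \<dots>, w n\<close> together with \<open>v 1 w 1\<close> have no common zero
  on \<open>X\<close>.  As \<open>X\<close> has dimension at most \<open>2n - 3\<close>, Bass's general position argument
  (\<open>stable_range\<close>) adds multiples of \<open>v 1 w 1 e\<close> to these entries such that they have no common
  zero on \<open>X\<close> any more.  Such an addition is an elementary operation on \<open>v\<close> or on \<open>w\<close>, since
  \<open>v 1 w 1\<close> is a multiple of both first entries.

  Secondly, the new entries generate the unit ideal modulo \<open>K\<close>.  Adding combinations of
  \<open>v 2, \<dots>, v n\<close> to \<open>v 1\<close> and of \<open>w 2, \<dots>, w n\<close> to \<open>w 1\<close> one can therefore prescribe the difference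
  of the first entries modulo \<open>K\<close>, and it is made \<open>\<equiv> 1\<close>.  The two first entries, now called \<open>V\<close> and
  \<open>W\<close>, then have no common zero on \<open>X\<close>, nor on \<open>V(I)\<close>, where both are \<open>\<equiv> 1\<close>; so \<open>V x - W y = 1\<close> for
  some \<open>x\<close> and \<open>y\<close>.

  Finally, with \<open>\<delta> = w j - v j \<in> I\<close>, the identity \<open>v j + V x \<delta> = w j + W y \<delta>\<close> shows how adding
  multiples of the first entries makes all the other entries agree.

  The operations only involve the matrices \<open>E 1 i (x)\<close> and
  \<open>E i 1 (x)\<close> with \<open>x \<in> I\<close>; for \<open>n \<ge> 3\<close> commutators produce all of them from the matrices
  \<open>E 2 1 (x)\<close> inside any normal subgroup (\<open>elem_mat_in_E_rel\<close>).
\<close>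

section \<open>Irreducible closed sets in noetherian spaces\<close>

text \<open>
  Noetherian induction: a closed set that is neither empty nor irreducible is the union of two
  smaller closed sets.
\<close>

lemma noetherian_space_decomposition:
  assumes X: "noetherian_space X" and A: "closedin X A"
  obtains F where "finite F" "\<Union>F = A"
    "\<And>Z. Z \<in> F \<Longrightarrow> closedin X Z \<and> irreducible_space (subtopology X Z)"
proof -
  let ?r = "{(A, B). closedin X A \<and> closedin X B \<and> A \<subset> B}"
  have "wf ?r"
    unfolding wf_iff_no_infinite_down_chain
  proof
    assume "\<exists>f. \<forall>i. (f (Suc i), f i) \<in> ?r"
    then obtain f where "\<forall>i. (f (Suc i), f i) \<in> ?r" by (rule exE)
    then have f: "\<forall>i. closedin X (f i)" "\<And>i. f (Suc i) \<subset> f i" by auto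
    then have "\<forall>i. f (Suc i) \<subseteq> f i" by blast
    then obtain N where N: "\<forall>i\<ge>N. f i = f N"
      using X f(1) unfolding noetherian_space_def by meson
    have "f (Suc N) = f N" using N by (meson le_SucI order_refl)
    then show False using f(2)[of N] by simp
  qed
  then have "\<exists>F. finite F \<and> \<Union>F = A
      \<and> (\<forall>Z\<in>F. closedin X Z \<and> irreducible_space (subtopology X Z))"
    using A
  proof (induction A rule: wf_induct_rule)
    case (less A)
    have top: "topspace (subtopology X A) = A"
      using closedin_subset[OF less.prems] by auto
    consider "A = {}" | "irreducible_space (subtopology X A)"
      | B D where "closedin (subtopology X A) B" "closedin (subtopology X A) D"
          "A = B \<union> D" "B \<noteq> A" "D \<noteq> A"
      unfolding irreducible_space_def top by blast
    then show ?case
    proof cases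
      case 1
      then show ?thesis by (intro exI[of _ "{}"]) simp
    next
      case 2
      then show ?thesis using less.prems by (intro exI[of _ "{A}"]) simp
    next
      case 3
      have BD: "closedin X B" "closedin X D"
        using 3(1,2) less.prems by (auto intro: closedin_trans_full)
      obtain F where F: "finite F" "\<Union>F = B"
        "\<forall>Z\<in>F. closedin X Z \<and> irreducible_space (subtopology X Z)"
        using less.IH[of B] BD 3 less.prems by auto
      obtain G where G: "finite G" "\<Union>G = D"
        "\<forall>Z\<in>G. closedin X Z \<and> irreducible_space (subtopology X Z)"
        using less.IH[of D] BD 3 less.prems by auto
      show ?thesis using F G 3(3) by (intro exI[of _ "F \<union> G"]) auto
    qed
  qed
  then show thesis using that by blast
qed

text \<open>
  Instead of a dimension for every piece of a decomposition, the proof carries along a chain of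
  irreducible closed sets of length \<open>k\<close> that starts at \<open>Z\<close>: such a chain grows by one whenever
  \<open>Z\<close> is cut down, and it is bounded by the dimension of the ambient space.
\<close>

definition codim_at_least :: "'a topology \<Rightarrow> 'a set \<Rightarrow> nat \<Rightarrow> bool" where
  "codim_at_least X Z k \<longleftrightarrow>
     (\<exists>W. W 0 = Z \<and>
       (\<forall>i\<le>k. closedin X (W i) \<and> irreducible_space (subtopology X (W i))) \<and>
       (\<forall>i<k. W i \<subset> W (Suc i)))"

lemma codim_at_least_closedin: "codim_at_least X Z k \<Longrightarrow> closedin X Z"
  unfolding codim_at_least_def by auto

lemma codim_at_least_le_top_dim: "codim_at_least X Z k \<Longrightarrow> enat k \<le> top_dim X"
  unfolding codim_at_least_def top_dim_def by (intro Sup_upper) blast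

lemma codim_at_least_0:
  assumes "closedin X Z" "irreducible_space (subtopology X Z)"
  shows "codim_at_least X Z 0"
  unfolding codim_at_least_def using assms by (intro exI[of _ "\<lambda>_. Z"]) simp

lemma codim_at_least_Suc:
  assumes Z: "codim_at_least X Z k" and Y: "closedin X Y" "irreducible_space (subtopology X Y)" "Y \<subset> Z"
  shows "codim_at_least X Y (Suc k)"
proof -
  obtain W where W: "W 0 = Z" "\<forall>i\<le>k. closedin X (W i) \<and> irreducible_space (subtopology X (W i))"
    "\<forall>i<k. W i \<subset> W (Suc i)"
    using Z unfolding codim_at_least_def by blast
  have "case_nat Y W i \<subset> case_nat Y W (Suc i)" if "i < Suc k" for i
    using that W Y by (cases i) auto
  moreover have "closedin X (case_nat Y W i) \<and> irreducible_space (subtopology X (case_nat Y W i))"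
    if "i \<le> Suc k" for i
    using that W Y by (cases i) auto
  ultimately show ?thesis
    unfolding codim_at_least_def by (intro exI[of _ "case_nat Y W"]) simp
qed

section \<open>Maximal ideals\<close>

context cring
begin

lemma proper_ideal_subset_maximalideal:
  assumes J: "ideal J R" and proper: "\<one> \<notin> J"
  obtains M where "maximalideal M R" "J \<subseteq> M"
proof -
  let ?A = "{K. ideal K R \<and> J \<subseteq> K \<and> \<one> \<notin> K}"
  have "\<exists>M\<in>?A. \<forall>X\<in>?A. M \<subseteq> X \<longrightarrow> X = M"
  proof (rule subset_Zorn_nonempty)
    show "?A \<noteq> {}" using J proper by blast
    fix \<C> assume ne: "\<C> \<noteq> {}" and ch: "subset.chain ?A \<C>"
    have "subset.chain {K. ideal K R} \<C>"
      using ch unfolding pred_on.chain_def by blast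
    from chain_Union_is_ideal[OF this] ne have "ideal (\<Union>\<C>) R" by simp
    then show "\<Union>\<C> \<in> ?A" using ch ne unfolding pred_on.chain_def by blast
  qed
  then obtain M where M: "ideal M R" "J \<subseteq> M" "\<one> \<notin> M"
    and max: "\<And>K. ideal K R \<Longrightarrow> M \<subseteq> K \<Longrightarrow> \<one> \<notin> K \<Longrightarrow> K = M"
    by (smt (verit, best) mem_Collect_eq order_trans)
  have "maximalideal M R"
  proof (rule maximalidealI[OF M(1)])
    show "carrier R \<noteq> M" using M(3) one_closed by blast
    show "K = M \<or> K = carrier R" if "ideal K R" "M \<subseteq> K" "K \<subseteq> carrier R" for K
      using that max ideal.one_imp_carrier by blast
  qed
  then show thesis using M(2) that by blast
qed

lemma maximalideal_one_notin: "maximalideal M R \<Longrightarrow> \<one> \<notin> M"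
  using maximalideal.I_notcarr maximalideal.axioms(1) ideal.one_imp_carrier by metis

text \<open>
  The ideal \<open>J'\<close> is the one generated by \<open>J\<close> and the entries \<open>f i\<close>.  A general base ideal \<open>J\<close>
  drives the induction and lets the entries of a second row be adjoined to the ideal that the first
  row has produced.
\<close>

lemma finite_row_ideal:
  assumes "finite S" and "ideal J R" and "f \<in> S \<rightarrow> carrier R"
  shows "\<exists>J'. ideal J' R \<and> J \<subseteq> J' \<and> f ` S \<subseteq> J' \<and>
    (\<forall>z\<in>J'. \<exists>j\<in>J. \<exists>p\<in>S \<rightarrow> carrier R. z = j \<oplus> (\<Oplus>i\<in>S. f i \<otimes> p i))"
  using assms
proof (induction S arbitrary: J rule: finite_induct)
  case empty
  have "z = z \<oplus> (\<Oplus>i\<in>{}. f i \<otimes> undefined i)" if "z \<in> J" for z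
    using that empty.prems(1) by (simp add: ideal.Icarr)
  then show ?case using empty by (intro exI[of _ J]) (auto simp: ideal.Icarr)
next
  case (insert x S)
  have fx: "f x \<in> carrier R" and fS: "f \<in> S \<rightarrow> carrier R" using insert.prems by auto
  let ?J = "J <+>\<^bsub>R\<^esub> PIdl (f x)"
  have J: "ideal ?J R" using insert.prems(1) fx by (intro add_ideals cgenideal_ideal)
  have "J \<subseteq> ?J"
  proof
    fix j assume "j \<in> J"
    moreover have "\<zero> \<in> PIdl (f x)"
      by (simp add: additive_subgroup.zero_closed cgenideal_ideal fx ideal.axioms(1))
    ultimately have "j \<oplus> \<zero> \<in> ?J" unfolding set_add_def' by blast
    then show "j \<in> ?J" using \<open>j \<in> J\<close> insert.prems(1) by (simp add: ideal.Icarr)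
  qed
  moreover have "f x \<in> ?J"
  proof -
    have "\<zero> \<oplus> f x \<in> ?J" unfolding set_add_def'
      using cgenideal_self[OF fx] additive_subgroup.zero_closed[OF ideal.axioms(1)[OF insert.prems(1)]]
      by blast
    then show ?thesis using fx by simp
  qed
  moreover obtain J' where J': "ideal J' R" "?J \<subseteq> J'" "f ` S \<subseteq> J'"
    "\<forall>z\<in>J'. \<exists>j\<in>?J. \<exists>p\<in>S \<rightarrow> carrier R. z = j \<oplus> (\<Oplus>i\<in>S. f i \<otimes> p i)"
    using insert.IH[OF J fS] by (elim exE conjE) (rule that)
  moreover have "\<exists>j\<in>J. \<exists>p\<in>insert x S \<rightarrow> carrier R. z = j \<oplus> (\<Oplus>i\<in>insert x S. f i \<otimes> p i)"
    if "z \<in> J'" for z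
  proof -
    obtain j' p where j': "j' \<in> ?J" and p: "p \<in> S \<rightarrow> carrier R"
      and z: "z = j' \<oplus> (\<Oplus>i\<in>S. f i \<otimes> p i)" using bspec[OF J'(4) \<open>z \<in> J'\<close>] by (elim bexE) (rule that)
    obtain j r where j: "j \<in> J" "r \<in> carrier R" "j' = j \<oplus> r \<otimes> f x"
      using j' unfolding set_add_def' cgenideal_def by blast
    have jc: "j \<in> carrier R" using j(1) insert.prems(1) by (simp add: ideal.Icarr)
    have "(\<Oplus>i\<in>insert x S. f i \<otimes> (p(x := r)) i) = f x \<otimes> r \<oplus> (\<Oplus>i\<in>S. f i \<otimes> (p(x := r)) i)"
      using insert.hyps fx fS p j(2) by (subst finsum_insert) (auto simp: Pi_iff)
    also have "(\<Oplus>i\<in>S. f i \<otimes> (p(x := r)) i) = (\<Oplus>i\<in>S. f i \<otimes> p i)"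
      using insert.hyps fS p by (intro finsum_cong') (auto simp: Pi_iff)
    finally have "z = j \<oplus> (\<Oplus>i\<in>insert x S. f i \<otimes> (p(x := r)) i)"
      using z j jc fx fS p by (simp add: a_assoc m_comm finsum_closed Pi_iff)
    moreover have "p(x := r) \<in> insert x S \<rightarrow> carrier R" using p j(2) by auto
    ultimately show ?thesis using j(1) by blast
  qed
  ultimately show ?case by (intro exI[of _ J']) auto
qed

text \<open>
  The product of elements \<open>y\<^sub>N \<in> N - M\<close>, for \<open>N \<in> P\<close>, is the required element because \<open>M\<close> is prime.
\<close>

lemma finite_maximalideals_separating_element:
  assumes "finite P" "\<And>N. N \<in> P \<Longrightarrow> maximalideal N R" "maximalideal M R" "M \<notin> P"
  shows "\<exists>s\<in>carrier R. s \<notin> M \<and> (\<forall>N\<in>P. s \<in> N)"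
  using assms
proof (induction P rule: finite_induct)
  case empty
  then show ?case using maximalideal_one_notin by blast
next
  case (insert N P)
  interpret M: maximalideal M R by fact
  interpret Np: maximalideal N R using insert by blast
  interpret Mp: primeideal M R by (rule maximalideal_prime) fact
  obtain s where s: "s \<in> carrier R" "s \<notin> M" "\<forall>N\<in>P. s \<in> N" using insert by auto
  have "\<not> N \<subseteq> M"
    using Np.I_maximal[OF M.is_ideal] M.I_notcarr M.a_subset insert.prems by auto
  then obtain y where y: "y \<in> N" "y \<notin> M" by blast
  then have yc: "y \<in> carrier R" by (simp add: Np.Icarr)
  have "s \<otimes> y \<notin> M" using Mp.I_prime s y yc by blast
  moreover have "s \<otimes> y \<in> N" using Np.I_l_closed y s by blast
  moreover have "\<forall>N\<in>P. s \<otimes> y \<in> N"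
    using s yc insert.prems(1) by (auto intro: ideal.I_r_closed maximalideal.axioms(1))
  ultimately show ?case using s yc by (intro bexI[of _ "s \<otimes> y"]) auto
qed

text \<open>
  This is how a single coefficient \<open>t\<close> moves a hypersurface off finitely many points outside
  \<open>V(b)\<close>.  The points are treated one after another: if the hypersurface passes through the next
  point \<open>M\<close>, then \<open>t\<close> is corrected by an element that vanishes at the earlier points but not at \<open>M\<close>.
\<close>

lemma translate_avoiding_maximalideals:
  assumes "finite P" "\<And>N. N \<in> P \<Longrightarrow> maximalideal N R \<and> b \<notin> N"
    and a: "a \<in> carrier R" and b: "b \<in> carrier R"
  shows "\<exists>t\<in>carrier R. \<forall>N\<in>P. a \<oplus> b \<otimes> t \<notin> N"
  using assms(1,2)
proof (induction P rule: finite_induct)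
  case empty
  then show ?case by blast
next
  case (insert M P)
  have M: "maximalideal M R" "b \<notin> M" using insert.prems by auto
  interpret M: maximalideal M R by fact
  interpret Mp: primeideal M R by (rule maximalideal_prime) fact
  obtain t where t: "t \<in> carrier R" "\<forall>N\<in>P. a \<oplus> b \<otimes> t \<notin> N" using insert by auto
  show ?case
  proof (cases "a \<oplus> b \<otimes> t \<in> M")
    case False
    then show ?thesis using t by blast
  next
    case True
    obtain s where s: "s \<in> carrier R" "s \<notin> M" "\<forall>N\<in>P. s \<in> N"
      using finite_maximalideals_separating_element[OF insert.hyps(1) _ M(1) insert.hyps(2)]
        insert.prems by blast
    have eq: "a \<oplus> b \<otimes> (t \<oplus> s) = (a \<oplus> b \<otimes> t) \<oplus> b \<otimes> s"
      using a b t(1) s(1) by (simp add: r_distr a_assoc)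
    have shift: "x \<oplus> y \<in> N \<longleftrightarrow> x \<in> N" if "ideal N R" "y \<in> N" "x \<in> carrier R" for x y N
    proof -
      interpret N: ideal N R by fact
      have "(x \<oplus> y) \<ominus> y = x" using that N.Icarr by (simp add: minus_eq a_assoc r_neg)
      then show ?thesis using N.a_closed N.a_inv_closed that(2) by (metis minus_eq)
    qed
    have "a \<oplus> b \<otimes> (t \<oplus> s) \<notin> M"
    proof -
      have "b \<otimes> s \<notin> M" using Mp.I_prime M(2) s b by blast
      then show ?thesis unfolding eq
        using shift[OF M.is_ideal True, of "b \<otimes> s"] a b s t by (simp add: a_comm)
    qed
    moreover have "a \<oplus> b \<otimes> (t \<oplus> s) \<notin> N" if "N \<in> P" for N
    proof -
      have N: "ideal N R" using insert.prems that maximalideal.axioms(1) by blast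
      have "b \<otimes> s \<in> N" using ideal.I_l_closed[OF N] s(3) that b by blast
      then show ?thesis unfolding eq using shift[OF N] t that a b by auto
    qed
    ultimately show ?thesis using s t by (intro bexI[of _ "t \<oplus> s"]) auto
  qed
qed

section \<open>Stable range of a closed part of the maximal spectrum\<close>

lemma closedin_zariski_element:
  assumes x: "x \<in> carrier R"
  shows "closedin (zariski R) {M \<in> max_spec R. x \<in> M}"
proof -
  have "{M \<in> max_spec R. x \<in> M} = V_max R (PIdl x)"
    using cgenideal_self[OF x] cgenideal_minimal maximalideal.axioms(1)
    unfolding V_max_def max_spec_def by blast
  then show ?thesis using cgenideal_ideal[OF x] closedin_zariski by blast
qed

text \<open>
  Bass's general position argument.  Outside \<open>V(b)\<close>, the common zeros of the modified elements lie
  in finitely many irreducible closed sets, and each further element increases their codimension: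
  choose a point outside \<open>V(b)\<close> in every set that has one, and choose the next coefficient such that
  the modified element vanishes at none of these points.  The sets that lie inside \<open>V(b)\<close> can be
  dropped.
\<close>

lemma general_position:
  fixes C :: "nat \<Rightarrow> 'a set set"
  assumes "finite S" and a: "a \<in> S \<rightarrow> carrier R" and b: "b \<in> carrier R"
    and cl: "\<forall>i<m. closedin (zariski R) (C i)"
    and irr: "\<forall>i<m. irreducible_space (subtopology (zariski R) (C i))"
    and noeth: "\<forall>i<m. noetherian_space (subtopology (zariski R) (C i))"
  shows "\<exists>t\<in>S \<rightarrow> carrier R. \<exists>F. finite F \<and>
     (\<forall>Z\<in>F. \<exists>i<m. codim_at_least (subtopology (zariski R) (C i)) Z (card S)) \<and>
     (\<forall>M\<in>(\<Union>i<m. C i). b \<notin> M \<longrightarrow> (\<forall>s\<in>S. a s \<oplus> b \<otimes> t s \<in> M) \<longrightarrow> M \<in> \<Union>F)"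
  using assms(1,2)
proof (induction S rule: finite_induct)
  case empty
  have "codim_at_least (subtopology (zariski R) (C i)) (C i) 0" if "i < m" for i
    using that cl irr closedin_subset[of "zariski R" "C i"]
    by (intro codim_at_least_0) (auto simp: closedin_subtopology_refl subtopology_subtopology)
  then show ?case by (intro bexI[of _ "\<lambda>_. \<zero>"] exI[of _ "C ` {..<m}"]) auto
next
  case (insert s S)
  let ?X = "\<lambda>i. subtopology (zariski R) (C i)"
  have as: "a s \<in> carrier R" using insert.prems by simp
  obtain t F where t: "t \<in> S \<rightarrow> carrier R" and F: "finite F"
    "\<forall>Z\<in>F. \<exists>i<m. codim_at_least (?X i) Z (card S)"
    and cover: "\<forall>M\<in>(\<Union>i<m. C i). b \<notin> M \<longrightarrow> (\<forall>s\<in>S. a s \<oplus> b \<otimes> t s \<in> M) \<longrightarrow> M \<in> \<Union>F"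
  proof -
    have aS: "a \<in> S \<rightarrow> carrier R" using insert.prems by auto
    show thesis using insert.IH[OF aS] by (elim bexE exE conjE) (rule that)
  qed
  have "\<forall>Z\<in>F. \<exists>i. i < m \<and> codim_at_least (?X i) Z (card S)" using F(2) by blast
  then obtain idx where idx: "\<And>Z. Z \<in> F \<Longrightarrow> idx Z < m \<and> codim_at_least (?X (idx Z)) Z (card S)"
    unfolding bchoice_iff by blast
  let ?F = "{Z \<in> F. \<exists>M\<in>Z. b \<notin> M}"
  have "\<forall>Z\<in>?F. \<exists>M. M \<in> Z \<and> b \<notin> M" by blast
  then obtain pt where pt: "\<And>Z. Z \<in> ?F \<Longrightarrow> pt Z \<in> Z \<and> b \<notin> pt Z"
    unfolding bchoice_iff by blast
  have sub: "Z \<subseteq> max_spec R" if "Z \<in> F" for Z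
    using codim_at_least_closedin[OF conjunct2[OF idx[OF that]], THEN closedin_subset]
    by (auto simp: topspace_zariski)
  have max: "maximalideal (pt Z) R" if "Z \<in> ?F" for Z
    using pt[OF that] sub that unfolding max_spec_def by blast
  have "\<exists>\<tau>\<in>carrier R. \<forall>N\<in>pt ` ?F. a s \<oplus> b \<otimes> \<tau> \<notin> N"
  proof (rule translate_avoiding_maximalideals)
    show "finite (pt ` ?F)" using F(1) by simp
    show "maximalideal N R \<and> b \<notin> N" if N: "N \<in> pt ` ?F" for N
    proof -
      obtain Z where "Z \<in> ?F" "N = pt Z" using N by (rule imageE)
      then show ?thesis using max[of Z] pt[of Z] by simp
    qed
  qed (rule as, rule b)
  then obtain \<tau> where \<tau>: "\<tau> \<in> carrier R" "\<And>Z. Z \<in> ?F \<Longrightarrow> a s \<oplus> b \<otimes> \<tau> \<notin> pt Z"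
    by blast
  let ?a = "a s \<oplus> b \<otimes> \<tau>"
  have ac: "?a \<in> carrier R" using as b \<tau> by simp
  \<comment> \<open>The zeros of the new element in \<open>Z\<close> miss \<open>pt Z\<close>, so their
    components are smaller than \<open>Z\<close>.\<close>
  have "\<exists>G. finite G \<and> \<Union>G = Z \<inter> {M \<in> max_spec R. ?a \<in> M} \<and>
     (\<forall>Y\<in>G. closedin (?X (idx Z)) Y \<and> irreducible_space (subtopology (?X (idx Z)) Y))"
    if Z: "Z \<in> ?F" for Z
  proof -
    have i: "idx Z < m" "closedin (?X (idx Z)) Z"
      using idx Z codim_at_least_closedin by auto
    have "closedin (?X (idx Z)) (Z \<inter> {M \<in> max_spec R. ?a \<in> M})"
      using i(2) closedin_zariski_element[OF ac] by (auto simp: closedin_subtopology)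
    from noetherian_space_decomposition[OF noeth[rule_format, OF i(1)] this] show ?thesis by metis
  qed
  then have "\<forall>Z\<in>?F. \<exists>G. finite G \<and> \<Union>G = Z \<inter> {M \<in> max_spec R. ?a \<in> M} \<and>
     (\<forall>Y\<in>G. closedin (?X (idx Z)) Y \<and> irreducible_space (subtopology (?X (idx Z)) Y))"
    by (rule ballI)
  from bchoice[OF this] obtain G where G: "\<forall>Z\<in>?F. finite (G Z) \<and> \<Union>(G Z) = Z \<inter> {M \<in> max_spec R. ?a \<in> M} \<and>
     (\<forall>Y\<in>G Z. closedin (?X (idx Z)) Y \<and> irreducible_space (subtopology (?X (idx Z)) Y))"
    by (rule exE)
  let ?t = "t(s := \<tau>)"
  show ?case
  proof (intro bexI[of _ ?t] exI[of _ "\<Union>(G ` ?F)"] conjI ballI impI)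
    show "finite (\<Union>(G ` ?F))" using F(1) G by simp
    show "?t \<in> insert s S \<rightarrow> carrier R" using t \<tau> by auto
    fix Y assume "Y \<in> \<Union>(G ` ?F)"
    then obtain Z where Z: "Z \<in> ?F" "Y \<in> G Z" by (rule UN_E)
    note GZ = bspec[OF G Z(1)]
    have "Y \<subset> Z" using GZ Z(2) pt[OF Z(1)] \<tau>(2)[OF Z(1)] by blast
    moreover have Zi: "idx Z < m" "codim_at_least (?X (idx Z)) Z (card S)"
      using idx[of Z] Z(1) by simp_all
    ultimately have "codim_at_least (?X (idx Z)) Y (Suc (card S))"
      using GZ Z(2) by (intro codim_at_least_Suc[OF Zi(2)]) auto
    then show "\<exists>i<m. codim_at_least (?X i) Y (card (insert s S))"
      using Zi insert.hyps by auto
  next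
    fix M assume M: "M \<in> (\<Union>i<m. C i)" "b \<notin> M"
      "\<forall>s'\<in>insert s S. a s' \<oplus> b \<otimes> ?t s' \<in> M"
    have "a s' \<oplus> b \<otimes> t s' \<in> M" if "s' \<in> S" for s'
    proof -
      have "s' \<noteq> s" using that insert.hyps by blast
      then show ?thesis using bspec[OF M(3), of s'] that by simp
    qed
    then have "M \<in> \<Union>F" using bspec[OF cover M(1)] M(2) by simp
    then obtain Z where Z: "Z \<in> F" "M \<in> Z" by (rule UnionE)
    then have ZF: "Z \<in> ?F" using M(2) by blast
    have "M \<in> Z \<inter> {M \<in> max_spec R. ?a \<in> M}" using Z sub M(3) by auto
    then have "M \<in> \<Union>(G Z)" using bspec[OF G ZF] by simp
    then show "M \<in> \<Union>(\<Union>(G ` ?F))" using ZF by blast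
  qed
qed

text \<open>
  Once there are more elements than the dimension of the sets \<open>C i\<close>, no piece of the required
  codimension is left, so the common zeros of the modified elements lie in \<open>V(b)\<close>.  There the
  modification has no effect, and \<open>unimod\<close> excludes them.
\<close>

lemma stable_range:
  fixes C :: "nat \<Rightarrow> 'a set set"
  assumes S: "finite S" and a: "a \<in> S \<rightarrow> carrier R" and b: "b \<in> carrier R"
    and cl: "\<forall>i<m. closedin (zariski R) (C i)"
    and irr: "\<forall>i<m. irreducible_space (subtopology (zariski R) (C i))"
    and noeth: "\<forall>i<m. noetherian_space (subtopology (zariski R) (C i))"
    and dim: "\<forall>i<m. top_dim (subtopology (zariski R) (C i)) \<le> enat d"
    and card: "d < card S"
    and unimod: "\<And>M. M \<in> (\<Union>i<m. C i) \<Longrightarrow> b \<in> M \<Longrightarrow> \<exists>s\<in>S. a s \<notin> M"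
  shows "\<exists>t\<in>S \<rightarrow> carrier R. \<forall>M\<in>(\<Union>i<m. C i). \<exists>s\<in>S. a s \<oplus> b \<otimes> t s \<notin> M"
proof -
  obtain t F where t: "t \<in> S \<rightarrow> carrier R"
    and F: "\<forall>Z\<in>F. \<exists>i<m. codim_at_least (subtopology (zariski R) (C i)) Z (card S)"
    and cover: "\<forall>M\<in>(\<Union>i<m. C i). b \<notin> M \<longrightarrow> (\<forall>s\<in>S. a s \<oplus> b \<otimes> t s \<in> M) \<longrightarrow> M \<in> \<Union>F"
    using general_position[OF S a b cl irr noeth] by (elim bexE exE conjE) (rule that)
  have "F = {}"
  proof (rule ccontr)
    assume "F \<noteq> {}"
    then obtain Z i where "i < m" "codim_at_least (subtopology (zariski R) (C i)) Z (card S)"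
      using F by blast
    then have "enat (card S) \<le> enat d" using codim_at_least_le_top_dim dim order_trans by blast
    then show False using card by simp
  qed
  have "\<exists>s\<in>S. a s \<oplus> b \<otimes> t s \<notin> M" if M: "M \<in> (\<Union>i<m. C i)" for M
  proof (rule ccontr)
    assume "\<not> ?thesis"
    then have all: "\<And>s. s \<in> S \<Longrightarrow> a s \<oplus> b \<otimes> t s \<in> M" by blast
    then have bM: "b \<in> M" using bspec[OF cover M] \<open>F = {}\<close> by blast
    then obtain s where s: "s \<in> S" "a s \<notin> M" using unimod M by blast
    have "M \<in> max_spec R" using M cl closedin_subset topspace_zariski by fastforce
    then interpret M: ideal M R unfolding max_spec_def by (simp add: maximalideal.axioms(1))
    have c: "a s \<in> carrier R" "t s \<in> carrier R" using s a t by auto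
    have "b \<otimes> t s \<in> M" using bM c M.I_r_closed by blast
    then have "(a s \<oplus> b \<otimes> t s) \<oplus> \<ominus> (b \<otimes> t s) \<in> M" using all[OF s(1)] M.a_closed M.a_inv_closed by blast
    then show False using s(2) c b by (simp add: a_assoc r_neg)
  qed
  then show ?thesis using t by blast
qed

end

section \<open>Elementary matrices and the relative elementary group\<close>

lemma (in ring) elem_mat_closed [simp]:
  "x \<in> carrier R \<Longrightarrow> elem_mat R n i j x \<in> carrier (mat_monoid R n)"
  by (auto simp: elem_mat_def mat_monoid_def)

text \<open>
  Products are only ever taken with an elementary matrix on the right, which is a column operation;
  this replaces the double sums of general matrix products by a formula for the entries.
\<close>

lemma (in ring) mat_mult_elem_mat:
  assumes A: "A \<in> carrier (mat_monoid R n)" and i: "i \<in> {1..n}" and x: "x \<in> carrier R"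
  shows "A \<otimes>\<^bsub>mat_monoid R n\<^esub> elem_mat R n i j x =
    (\<lambda>(k, l)\<in>{1..n} \<times> {1..n}. A (k, l) \<oplus> (if l = j then A (k, i) \<otimes> x else \<zero>))"
proof -
  have cl: "A (k, l) \<in> carrier R" if "k \<in> {1..n}" "l \<in> {1..n}" for k l
    using A that by (auto simp: mat_monoid_def)
  have "(\<Oplus>q\<in>{1..n}. A (k, q) \<otimes> elem_mat R n i j x (q, l))
      = A (k, l) \<oplus> (if l = j then A (k, i) \<otimes> x else \<zero>)"
    if kl: "k \<in> {1..n}" "l \<in> {1..n}" for k l
  proof -
    have "(\<Oplus>q\<in>{1..n}. A (k, q) \<otimes> elem_mat R n i j x (q, l))
        = (\<Oplus>q\<in>{1..n}. (if l = q then A (k, q) else \<zero>) \<oplus>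
             (if i = q then if l = j then A (k, q) \<otimes> x else \<zero> else \<zero>))"
      using kl cl x by (intro finsum_cong') (auto simp: elem_mat_def r_distr)
    also have "\<dots> = (\<Oplus>q\<in>{1..n}. if l = q then A (k, q) else \<zero>) \<oplus>
        (\<Oplus>q\<in>{1..n}. if i = q then if l = j then A (k, q) \<otimes> x else \<zero> else \<zero>)"
      using kl cl x by (intro finsum_addf) auto
    also have "\<dots> = A (k, l) \<oplus> (if l = j then A (k, i) \<otimes> x else \<zero>)"
      using kl cl x i by (subst (1 2) finsum_singleton) auto
    finally show ?thesis .
  qed
  then show ?thesis by (auto simp: mat_monoid_def restrict_def fun_eq_iff)
qed

lemma (in ring) elem_mat_zero: "elem_mat R n i j \<zero> = \<one>\<^bsub>mat_monoid R n\<^esub>"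
  by (auto simp: elem_mat_def mat_monoid_def restrict_def fun_eq_iff)

lemma (in ring) elem_mat_mult_same:
  assumes "i \<in> {1..n}" "i \<noteq> j" "x \<in> carrier R" "y \<in> carrier R"
  shows "elem_mat R n i j x \<otimes>\<^bsub>mat_monoid R n\<^esub> elem_mat R n i j y = elem_mat R n i j (x \<oplus> y)"
  using assms by (simp add: mat_mult_elem_mat) (auto simp: elem_mat_def restrict_def fun_eq_iff)

text \<open>
  The Steinberg commutator relation \<open>[E i j (a), E j k (b)] = E i k (a b)\<close>, with the inverses
  written out.
\<close>

lemma (in cring) elem_mat_commutator:
  assumes ijk: "i \<in> {1..n}" "j \<in> {1..n}" "k \<in> {1..n}" "i \<noteq> j" "i \<noteq> k" "j \<noteq> k"
    and a: "a \<in> carrier R" and b: "b \<in> carrier R"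
  shows "((elem_mat R n i j a \<otimes>\<^bsub>mat_monoid R n\<^esub> elem_mat R n j k b)
      \<otimes>\<^bsub>mat_monoid R n\<^esub> elem_mat R n i j (\<ominus> a)) \<otimes>\<^bsub>mat_monoid R n\<^esub> elem_mat R n j k (\<ominus> b)
    = elem_mat R n i k (a \<otimes> b)"
proof -
  let ?M = "mat_monoid R n"
  interpret M: monoid ?M by (rule monoid_mat_monoid)
  define P where "P = elem_mat R n i j a"
  define P' where "P' = P \<otimes>\<^bsub>?M\<^esub> elem_mat R n j k b"
  define Q where "Q = P' \<otimes>\<^bsub>?M\<^esub> elem_mat R n i j (\<ominus> a)"
  define Q' where "Q' = Q \<otimes>\<^bsub>?M\<^esub> elem_mat R n j k (\<ominus> b)"
  have cl: "P \<in> carrier ?M" "P' \<in> carrier ?M" "Q \<in> carrier ?M" "Q' \<in> carrier ?M"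
    using a b by (simp_all add: P_def P'_def Q_def Q'_def)
  have entry: "(A \<otimes>\<^bsub>?M\<^esub> elem_mat R n r s x) (p, q) = A (p, q) \<oplus> (if q = s then A (p, r) \<otimes> x else \<zero>)"
    if "A \<in> carrier ?M" "r \<in> {1..n}" "x \<in> carrier R" "p \<in> {1..n}" "q \<in> {1..n}" for A r s x p q
    using that(4,5) by (simp add: mat_mult_elem_mat[OF that(1-3)])
  have "Q' (p, q) = elem_mat R n i k (a \<otimes> b) (p, q)" if pq: "p \<in> {1..n}" "q \<in> {1..n}" for p q
  proof -
    have P: "P (p, q) = (if p = q then \<one> else \<zero>) \<oplus> (if p = i \<and> q = j then a else \<zero>)"
      if "q \<in> {1..n}" for q
      using pq that by (simp add: P_def elem_mat_def)
    have P': "P' (p, q) = P (p, q) \<oplus> (if q = k then P (p, j) \<otimes> b else \<zero>)" if "q \<in> {1..n}" for q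
      unfolding P'_def using cl ijk a b pq that by (intro entry) auto
    have Q: "Q (p, q) = P' (p, q) \<oplus> (if q = j then P' (p, i) \<otimes> (\<ominus> a) else \<zero>)" if "q \<in> {1..n}" for q
      unfolding Q_def using cl ijk a b pq that by (intro entry) auto
    have Q': "Q' (p, q) = Q (p, q) \<oplus> (if q = k then Q (p, j) \<otimes> (\<ominus> b) else \<zero>)" if "q \<in> {1..n}" for q
      unfolding Q'_def using cl ijk a b pq that by (intro entry) auto
    have rhs: "elem_mat R n i k (a \<otimes> b) (p, q)
        = (if p = q then \<one> else \<zero>) \<oplus> (if p = i \<and> q = k then a \<otimes> b else \<zero>)"
      using pq by (simp add: elem_mat_def)
    show ?thesis
      unfolding Q'[OF pq(2)] Q[OF pq(2)] Q[OF ijk(2)] P'[OF pq(2)] P'[OF ijk(1)] P'[OF ijk(2)]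
        P[OF pq(2)] P[OF ijk(1)] P[OF ijk(2)] rhs
      using ijk(4-6) a b
      by (cases "p = i"; cases "p = j"; cases "p = k"; cases "q = j"; cases "q = k";
          simp add: r_neg l_neg r_minus l_minus a_assoc minus_minus)
  qed
  then have "Q' = elem_mat R n i k (a \<otimes> b)"
    using cl(4) elem_mat_closed[of "a \<otimes> b" n i k] a b
    by (intro PiE_ext[of _ "{1..n} \<times> {1..n}" "\<lambda>_. carrier R"]) (auto simp: mat_monoid_def)
  then show ?thesis by (simp add: P_def P'_def Q_def Q'_def)
qed

text \<open>
  The relative elementary group is an intersection of normal subgroups of the elementary group, so
  membership in it is checked in each such subgroup.
\<close>

locale elementary_normal = cring +
  fixes n N
  assumes normal: "N \<lhd> E_grp R n"
begin

abbreviation "E \<equiv> elem_mat R n"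

lemma mult_E_grp [simp]: "mult (E_grp R n) = mult (mat_monoid R n)"
  and one_E_grp [simp]: "one (E_grp R n) = one (mat_monoid R n)"
  by (simp_all add: E_grp_def GL_def units_of_def)

lemma E_closed:
  assumes "i \<in> {1..n}" "j \<in> {1..n}" "i \<noteq> j" "x \<in> carrier R"
  shows "E i j x \<in> carrier (E_grp R n)"
  using assms by (auto simp: E_grp_def intro!: generate.incl)

interpretation N: normal N "E_grp R n" by (rule normal)

lemma N_mult: "A \<in> N \<Longrightarrow> B \<in> N \<Longrightarrow> A \<otimes>\<^bsub>E_grp R n\<^esub> B \<in> N"
  using subgroup.m_closed[OF normal.axioms(1)[OF normal]] .

lemma E_inverse:
  assumes "i \<in> {1..n}" "j \<in> {1..n}" "i \<noteq> j" "x \<in> carrier R"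
  shows "inv\<^bsub>E_grp R n\<^esub> (E i j x) = E i j (\<ominus> x)"
  using assms by (intro N.inv_equality) (auto simp: E_closed elem_mat_mult_same l_neg elem_mat_zero)

lemma E_uminus:
  assumes "i \<in> {1..n}" "j \<in> {1..n}" "i \<noteq> j" "x \<in> carrier R" "E i j x \<in> N"
  shows "E i j (\<ominus> x) \<in> N"
  using N.m_inv_closed[OF assms(5)] E_inverse[OF assms(1-4)] by simp

text \<open>
  If one factor of a commutator lies in a normal subgroup then so does the commutator; with
  \<open>\<one>\<close> as the parameter of the other factor, the Steinberg relation moves \<open>x\<close> to another row, and in
  the next lemma to another column.
\<close>

lemma E_move_row:
  assumes ijk: "i \<in> {1..n}" "j \<in> {1..n}" "k \<in> {1..n}" "i \<noteq> j" "i \<noteq> k" "j \<noteq> k"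
    and x: "x \<in> carrier R" and N: "E j k x \<in> N"
  shows "E i k x \<in> N"
proof -
  have "(E i j \<one> \<otimes>\<^bsub>E_grp R n\<^esub> E j k x) \<otimes>\<^bsub>E_grp R n\<^esub> inv\<^bsub>E_grp R n\<^esub> (E i j \<one>) \<in> N"
    using ijk N by (intro N.inv_op_closed2 E_closed) auto
  moreover have "E j k (\<ominus> x) \<in> N" using ijk x N by (intro E_uminus)
  ultimately have "((E i j \<one> \<otimes>\<^bsub>E_grp R n\<^esub> E j k x) \<otimes>\<^bsub>E_grp R n\<^esub> inv\<^bsub>E_grp R n\<^esub> (E i j \<one>))
      \<otimes>\<^bsub>E_grp R n\<^esub> E j k (\<ominus> x) \<in> N"
    by (rule N_mult)
  then show ?thesis using elem_mat_commutator[OF ijk one_closed x] ijk x by (simp add: E_inverse)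
qed

lemma E_move_column:
  assumes ijk: "i \<in> {1..n}" "j \<in> {1..n}" "k \<in> {1..n}" "i \<noteq> j" "i \<noteq> k" "j \<noteq> k"
    and x: "x \<in> carrier R" and N: "E i j x \<in> N"
  shows "E i k x \<in> N"
proof -
  have cl: "E i j x \<in> carrier (E_grp R n)" "E j k \<one> \<in> carrier (E_grp R n)"
    "E i j (\<ominus> x) \<in> carrier (E_grp R n)" "E j k (\<ominus> \<one>) \<in> carrier (E_grp R n)"
    using ijk x by (auto intro!: E_closed)
  have "(E j k \<one> \<otimes>\<^bsub>E_grp R n\<^esub> E i j (\<ominus> x)) \<otimes>\<^bsub>E_grp R n\<^esub> inv\<^bsub>E_grp R n\<^esub> (E j k \<one>) \<in> N"
    using ijk x N by (intro N.inv_op_closed2 E_closed E_uminus) auto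
  from N_mult[OF N this]
  have "((E i j x \<otimes>\<^bsub>E_grp R n\<^esub> E j k \<one>) \<otimes>\<^bsub>E_grp R n\<^esub> E i j (\<ominus> x))
      \<otimes>\<^bsub>E_grp R n\<^esub> E j k (\<ominus> \<one>) \<in> N"
    using cl ijk by (simp add: E_inverse N.m_assoc del: mult_E_grp)
  then show ?thesis using elem_mat_commutator[OF ijk x one_closed] x by simp
qed

text \<open>
  From position \<open>(2, 1)\<close> one reaches \<open>(i, 1)\<close> directly, \<open>(1, j)\<close> with \<open>j \<ge> 3\<close> through \<open>(2, j)\<close>, and
  \<open>(1, 2)\<close> through \<open>(1, 3)\<close>; the index \<open>3\<close> exists as \<open>n \<ge> 3\<close>.
\<close>

lemma E_first_row_column:
  assumes n: "n \<ge> 3" and x: "x \<in> carrier R" and N: "E 2 1 x \<in> N" and i: "i \<in> {2..n}"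
  shows "E i 1 x \<in> N" "E 1 i x \<in> N"
proof -
  show "E i 1 x \<in> N"
    using E_move_row[of i 2 1 x] n x N i by (cases "i = 2") auto
  have *: "E 1 j x \<in> N" if j: "j \<in> {3..n}" for j
  proof -
    have "E 2 j x \<in> N" using E_move_column[of 2 1 j x] n x N j by auto
    then show ?thesis using E_move_row[of 1 2 j x] n x j by auto
  qed
  show "E 1 i x \<in> N"
    using E_move_column[of 1 3 2 x] *[of 3] *[of i] n x i by (cases "i = 2") auto
qed

end

context cring
begin

lemma elem_mat_in_E_rel:
  assumes "n \<ge> 3" "ideal I R" "x \<in> I" "i \<in> {2..n}"
  shows "elem_mat R n i 1 x \<in> E_rel R n I" "elem_mat R n 1 i x \<in> E_rel R n I"
proof -
  have x: "x \<in> carrier R" using assms by (simp add: ideal.Icarr)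
  have "elem_mat R n i 1 x \<in> N \<and> elem_mat R n 1 i x \<in> N"
    if "N \<lhd> E_grp R n" "\<forall>x\<in>I. elem_mat R n 2 1 x \<in> N" for N
  proof -
    interpret elementary_normal R n N by (intro elementary_normal.intro elementary_normal_axioms.intro cring_axioms that(1))
    show ?thesis using E_first_row_column[OF assms(1) x] that(2) assms(3,4) by blast
  qed
  then show "elem_mat R n i 1 x \<in> E_rel R n I" "elem_mat R n 1 i x \<in> E_rel R n I"
    unfolding E_rel_def by auto
qed

lemma one_in_E_rel: "\<one>\<^bsub>mat_monoid R n\<^esub> \<in> E_rel R n I"
proof -
  have "\<one>\<^bsub>E_grp R n\<^esub> \<in> N" if "N \<lhd> E_grp R n" for N
    using that by (meson normal.axioms(1) subgroup.one_closed)
  then show ?thesis unfolding E_rel_def by (auto simp: E_grp_def GL_def units_of_def)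
qed

lemma mult_in_E_rel:
  assumes "A \<in> E_rel R n I" "B \<in> E_rel R n I"
  shows "A \<otimes>\<^bsub>mat_monoid R n\<^esub> B \<in> E_rel R n I"
proof -
  have "A \<otimes>\<^bsub>E_grp R n\<^esub> B \<in> N" if "N \<lhd> E_grp R n" "A \<in> N" "B \<in> N" for N A B
    using that by (meson normal.axioms(1) subgroup.m_closed)
  then show ?thesis using assms unfolding E_rel_def by (auto simp: E_grp_def GL_def units_of_def)
qed

section \<open>Relative elementary operations on rows\<close>

text \<open>
  Intersecting with the matrices over \<open>R\<close> makes it immediate that the entries of the acting matrices,
  and hence of the resulting rows, lie in \<open>R\<close>.
\<close>

definition rel_orbit :: "nat \<Rightarrow> 'a set \<Rightarrow> (nat \<Rightarrow> 'a) \<Rightarrow> (nat \<Rightarrow> 'a) set" where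
  "rel_orbit n I v = row_mult R n v ` (E_rel R n I \<inter> carrier (mat_monoid R n))"

lemma rel_orbit_refl:
  assumes v: "v \<in> rows R n"
  shows "v \<in> rel_orbit n I v"
proof -
  interpret M: monoid "mat_monoid R n" by (rule monoid_mat_monoid)
  have cl: "v i \<in> carrier R" if "i \<in> {1..n}" for i using v that by (auto simp: rows_def)
  have "(\<Oplus>i\<in>{1..n}. v i \<otimes> \<one>\<^bsub>mat_monoid R n\<^esub> (i, j)) = v j" if j: "j \<in> {1..n}" for j
  proof -
    have "(\<Oplus>i\<in>{1..n}. v i \<otimes> \<one>\<^bsub>mat_monoid R n\<^esub> (i, j)) = (\<Oplus>i\<in>{1..n}. if j = i then v i else \<zero>)"
      using j cl by (intro finsum_cong') (auto simp: mat_monoid_def)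
    then show ?thesis using j cl by (subst (asm) finsum_singleton) auto
  qed
  moreover have "v j = undefined" if "j \<notin> {1..n}" for j
    using v that by (auto simp: rows_def PiE_def extensional_def)
  ultimately have "row_mult R n v \<one>\<^bsub>mat_monoid R n\<^esub> = v"
    unfolding row_mult_def restrict_def by (intro ext) (simp del: atLeastAtMost_iff)
  then show ?thesis unfolding rel_orbit_def using one_in_E_rel[of n I] by force
qed

text \<open>
  This is the associativity of the action of matrices on rows, for an elementary factor on the right,
  where it comes down to the additivity of finite sums.
\<close>

lemma rel_orbit_elem_mat:
  assumes v: "v \<in> rows R n" and u: "u \<in> rel_orbit n I v"
    and E: "elem_mat R n i j x \<in> E_rel R n I"
    and ij: "i \<in> {1..n}" "j \<in> {1..n}" and x: "x \<in> carrier R"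
  shows "u(j := u j \<oplus> u i \<otimes> x) \<in> rel_orbit n I v"
proof -
  let ?M = "mat_monoid R n"
  interpret M: monoid ?M by (rule monoid_mat_monoid)
  obtain A where A: "A \<in> E_rel R n I" "A \<in> carrier ?M" and uA: "u = row_mult R n v A"
    using u unfolding rel_orbit_def by blast
  have vc: "v k \<in> carrier R" if "k \<in> {1..n}" for k using v that by (auto simp: rows_def)
  have Ac: "A (k, l) \<in> carrier R" if "k \<in> {1..n}" "l \<in> {1..n}" for k l
    using A(2) that by (auto simp: mat_monoid_def)
  have uk: "u k = (\<Oplus>q\<in>{1..n}. v q \<otimes> A (q, k))" if "k \<in> {1..n}" for k
    using that uA by (simp add: row_mult_def)
  let ?B = "A \<otimes>\<^bsub>?M\<^esub> elem_mat R n i j x"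
  have B: "?B (k, l) = A (k, l) \<oplus> (if l = j then A (k, i) \<otimes> x else \<zero>)"
    if "k \<in> {1..n}" "l \<in> {1..n}" for k l
    using that by (simp add: mat_mult_elem_mat[OF A(2) ij(1) x])
  have "(\<Oplus>q\<in>{1..n}. v q \<otimes> ?B (q, k)) = (u(j := u j \<oplus> u i \<otimes> x)) k" if k: "k \<in> {1..n}" for k
  proof (cases "k = j")
    case False
    then have "(\<Oplus>q\<in>{1..n}. v q \<otimes> ?B (q, k)) = (\<Oplus>q\<in>{1..n}. v q \<otimes> A (q, k))"
      using k vc Ac by (intro finsum_cong') (auto simp: B)
    then show ?thesis using False uk k by simp
  next
    case True
    have "(\<Oplus>q\<in>{1..n}. v q \<otimes> ?B (q, k)) =
        (\<Oplus>q\<in>{1..n}. v q \<otimes> A (q, j) \<oplus> (v q \<otimes> A (q, i)) \<otimes> x)"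
      using k True vc Ac ij x by (intro finsum_cong') (auto simp: B r_distr m_assoc)
    also have "\<dots> = (\<Oplus>q\<in>{1..n}. v q \<otimes> A (q, j)) \<oplus> (\<Oplus>q\<in>{1..n}. (v q \<otimes> A (q, i)) \<otimes> x)"
      using vc Ac ij x by (intro finsum_addf) auto
    also have "(\<Oplus>q\<in>{1..n}. (v q \<otimes> A (q, i)) \<otimes> x) = (\<Oplus>q\<in>{1..n}. v q \<otimes> A (q, i)) \<otimes> x"
      using vc Ac ij x by (intro finsum_ldistr[symmetric]) auto
    finally show ?thesis using True uk ij by simp
  qed
  moreover have "(u(j := u j \<oplus> u i \<otimes> x)) k = undefined" if "k \<notin> {1..n}" for k
    using that uA ij by (auto simp: row_mult_def)
  ultimately have "row_mult R n v ?B = u(j := u j \<oplus> u i \<otimes> x)"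
    unfolding row_mult_def restrict_def by (intro ext) (simp del: atLeastAtMost_iff fun_upd_apply)
  moreover have "?B \<in> E_rel R n I" using A(1) E by (rule mult_in_E_rel)
  moreover have "?B \<in> carrier ?M" using A(2) x by simp
  ultimately show ?thesis unfolding rel_orbit_def by (metis IntI image_eqI)
qed

lemma rel_orbit_rows:
  assumes v: "v \<in> rows R n" and u: "u \<in> rel_orbit n I v"
  shows "u \<in> rows R n"
proof -
  obtain A where A: "A \<in> carrier (mat_monoid R n)" and uA: "u = row_mult R n v A"
    using u unfolding rel_orbit_def by blast
  have "v i \<otimes> A (i, j) \<in> carrier R" if "i \<in> {1..n}" "j \<in> {1..n}" for i j
  proof -
    have "v i \<in> carrier R" "A (i, j) \<in> carrier R"
      using v A that by (auto simp: rows_def mat_monoid_def)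
    then show ?thesis by simp
  qed
  then show ?thesis unfolding uA row_mult_def rows_def
    by (intro restrict_PiE_iff[THEN iffD2] ballI finsum_closed) auto
qed

lemma rel_orbit_add_first_to_others:
  assumes n: "n \<ge> 3" and I: "ideal I R" and v: "v \<in> rows R n" and u: "u \<in> rel_orbit n I v"
    and S: "S \<subseteq> {2..n}" and x: "x \<in> S \<rightarrow> I"
  shows "(\<lambda>j. if j \<in> S then u j \<oplus> u 1 \<otimes> x j else u j) \<in> rel_orbit n I v"
proof -
  have "finite S" using S finite_subset by blast
  then show ?thesis using S x
  proof (induction S rule: finite_induct)
    case empty
    then show ?case using u by simp
  next
    case (insert s S)
    let ?u = "\<lambda>j. if j \<in> S then u j \<oplus> u 1 \<otimes> x j else u j"
    have xs: "x s \<in> I" "x s \<in> carrier R" using insert.prems I by (auto simp: ideal.Icarr)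
    have "?u(s := ?u s \<oplus> ?u 1 \<otimes> x s) \<in> rel_orbit n I v"
      using insert xs elem_mat_in_E_rel(2)[OF n I xs(1), of s]
      by (intro rel_orbit_elem_mat[OF v]) auto
    moreover have "?u(s := ?u s \<oplus> ?u 1 \<otimes> x s)
        = (\<lambda>j. if j \<in> insert s S then u j \<oplus> u 1 \<otimes> x j else u j)"
      using insert by (auto simp: fun_eq_iff)
    ultimately show ?case by simp
  qed
qed

lemma rel_orbit_add_others_to_first:
  assumes n: "n \<ge> 3" and I: "ideal I R" and v: "v \<in> rows R n" and u: "u \<in> rel_orbit n I v"
    and S: "S \<subseteq> {2..n}" and x: "x \<in> S \<rightarrow> I"
  shows "u(1 := u 1 \<oplus> (\<Oplus>i\<in>S. u i \<otimes> x i)) \<in> rel_orbit n I v"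
proof -
  have uc: "u i \<in> carrier R" if "i \<in> {1..n}" for i
    using rel_orbit_rows[OF v u] that by (auto simp: rows_def)
  have "finite S" using S finite_subset by blast
  then show ?thesis using S x
  proof (induction S rule: finite_induct)
    case empty
    then show ?case using u uc n by simp
  next
    case (insert s S)
    let ?u = "u(1 := u 1 \<oplus> (\<Oplus>i\<in>S. u i \<otimes> x i))"
    have xs: "x s \<in> I" "x s \<in> carrier R" and xS: "x \<in> S \<rightarrow> carrier R"
      using insert.prems I by (auto simp: ideal.Icarr Pi_iff)
    have c: "u 1 \<in> carrier R" "u s \<in> carrier R" "\<And>i. i \<in> S \<Longrightarrow> u i \<in> carrier R"
      using uc insert.prems n by auto
    have IH: "?u \<in> rel_orbit n I v" using insert.prems by (intro insert.IH) auto
    have "?u(1 := ?u 1 \<oplus> ?u s \<otimes> x s) \<in> rel_orbit n I v"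
    proof (rule rel_orbit_elem_mat[OF v IH])
      show "elem_mat R n s 1 (x s) \<in> E_rel R n I"
        using insert.prems by (intro elem_mat_in_E_rel(1)[OF n I xs(1)]) auto
    qed (use insert.prems n xs in auto)
    moreover have "(\<Oplus>i\<in>insert s S. u i \<otimes> x i) = u s \<otimes> x s \<oplus> (\<Oplus>i\<in>S. u i \<otimes> x i)"
      using insert.hyps c xs xS by (subst finsum_insert) auto
    moreover have "(\<Oplus>i\<in>S. u i \<otimes> x i) \<in> carrier R" using c xS by (intro finsum_closed) auto
    moreover have "s \<noteq> 1" using insert.prems by auto
    ultimately have "?u(1 := ?u 1 \<oplus> ?u s \<otimes> x s) = u(1 := u 1 \<oplus> (\<Oplus>i\<in>insert s S. u i \<otimes> x i))"
      using c xs by (simp add: fun_eq_iff a_ac)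
    then show ?case using \<open>?u(1 := ?u 1 \<oplus> ?u s \<otimes> x s) \<in> rel_orbit n I v\<close> by (simp only:)
  qed
qed

end

section \<open>Comaximality and unimodular rows\<close>

context cring
begin

lemma ideal_finsum_closed:
  assumes J: "ideal J R" and "finite S" and "\<And>i. i \<in> S \<Longrightarrow> f i \<in> J"
  shows "(\<Oplus>i\<in>S. f i) \<in> J"
  using assms(2,3)
proof (induction S rule: finite_induct)
  case empty
  then show ?case using J by (simp add: additive_subgroup.zero_closed ideal.axioms(1))
next
  case (insert s S)
  then have "f s \<in> J" "(\<Oplus>i\<in>S. f i) \<in> J" by auto
  moreover have "(\<Oplus>i\<in>insert s S. f i) = f s \<oplus> (\<Oplus>i\<in>S. f i)"
    using insert ideal.Icarr[OF J] by (intro finsum_insert) auto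
  ultimately show ?case using additive_subgroup.a_closed[OF ideal.axioms(1)[OF J]] by simp
qed

text \<open>
  Otherwise \<open>J + K\<close> would lie in a maximal ideal.
\<close>

lemma comaximal_ideals:
  assumes J: "ideal J R" and K: "ideal K R"
    and no: "\<And>M. maximalideal M R \<Longrightarrow> J \<subseteq> M \<Longrightarrow> K \<subseteq> M \<Longrightarrow> False"
  obtains j k where "j \<in> J" "k \<in> K" "j \<oplus> k = \<one>"
proof -
  have zero: "\<zero> \<in> J" "\<zero> \<in> K"
    using J K by (simp_all add: additive_subgroup.zero_closed ideal.axioms(1))
  have "\<one> \<in> J <+>\<^bsub>R\<^esub> K"
  proof (rule ccontr)
    assume "\<one> \<notin> J <+>\<^bsub>R\<^esub> K"
    then obtain M where M: "maximalideal M R" "J <+>\<^bsub>R\<^esub> K \<subseteq> M"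
      using proper_ideal_subset_maximalideal add_ideals[OF J K] by blast
    have "J \<subseteq> J <+>\<^bsub>R\<^esub> K"
    proof
      fix j assume j: "j \<in> J"
      then have "j \<oplus> \<zero> \<in> J <+>\<^bsub>R\<^esub> K" using zero unfolding set_add_def' by blast
      then show "j \<in> J <+>\<^bsub>R\<^esub> K" using j ideal.Icarr[OF J] by simp
    qed
    moreover have "K \<subseteq> J <+>\<^bsub>R\<^esub> K"
    proof
      fix k assume k: "k \<in> K"
      then have "\<zero> \<oplus> k \<in> J <+>\<^bsub>R\<^esub> K" using zero unfolding set_add_def' by blast
      then show "k \<in> J <+>\<^bsub>R\<^esub> K" using k ideal.Icarr[OF K] by simp
    qed
    ultimately show False using no M by blast
  qed
  then show thesis unfolding set_add_def' using that by auto
qed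

lemma comaximal_elements:
  assumes p: "p \<in> carrier R" and q: "q \<in> carrier R"
    and no: "\<And>M. maximalideal M R \<Longrightarrow> p \<in> M \<Longrightarrow> q \<in> M \<Longrightarrow> False"
  obtains x y where "x \<in> carrier R" "y \<in> carrier R" "p \<otimes> x \<ominus> q \<otimes> y = \<one>"
proof -
  obtain j k where jk: "j \<in> PIdl p" "k \<in> PIdl q" "j \<oplus> k = \<one>"
    using comaximal_ideals[OF cgenideal_ideal[OF p] cgenideal_ideal[OF q]] no
      cgenideal_self[OF p] cgenideal_self[OF q] by blast
  then obtain x y where xy: "x \<in> carrier R" "y \<in> carrier R" "j = x \<otimes> p" "k = y \<otimes> q"
    unfolding cgenideal_def by blast
  have "p \<otimes> x \<ominus> q \<otimes> (\<ominus> y) = \<one>"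
    using jk xy p q by (simp add: minus_eq r_minus minus_minus m_comm)
  then show thesis using that xy by blast
qed

lemma Um_not_in_maximalideal:
  assumes v: "v \<in> Um R n" and M: "maximalideal M R"
  shows "\<exists>i\<in>{1..n}. v i \<notin> M"
proof (rule ccontr)
  assume "\<not> ?thesis"
  then have vM: "\<And>i. i \<in> {1..n} \<Longrightarrow> v i \<in> M" by blast
  obtain w where w: "w \<in> rows R n" "(\<Oplus>i\<in>{1..n}. v i \<otimes> w i) = \<one>"
    using v unfolding Um_def by blast
  have I: "ideal M R" using M by (rule maximalideal.axioms(1))
  have "(\<Oplus>i\<in>{1..n}. v i \<otimes> w i) \<in> M"
    using vM w(1) by (intro ideal_finsum_closed[OF I] ideal.I_r_closed[OF I]) (auto simp: rows_def)
  then show False using w(2) maximalideal_one_notin[OF M] by simp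
qed

lemma Um_rel_entries:
  assumes v: "v \<in> Um_rel R n I" and I: "ideal I R" and n: "n \<ge> 1"
  shows "v \<in> Um R n" "v \<in> rows R n" "\<And>i. i \<in> {1..n} \<Longrightarrow> v i \<in> carrier R"
    "v 1 \<ominus> \<one> \<in> I" "\<And>i. i \<in> {2..n} \<Longrightarrow> v i \<in> I"
proof -
  show *: "v \<in> Um R n" "v \<in> rows R n" "\<And>i. i \<in> {1..n} \<Longrightarrow> v i \<in> carrier R"
    using v unfolding Um_rel_def Um_def rows_def by auto
  have E: "\<forall>i\<in>{1..n}. v i \<ominus> (if i = 1 then \<one> else \<zero>) \<in> I"
    using v unfolding Um_rel_def by blast
  show "v 1 \<ominus> \<one> \<in> I" using bspec[OF E, of 1] n by simp
  show "v i \<in> I" if "i \<in> {2..n}" for i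
    using bspec[OF E, of i] that *(3)[of i] by (simp add: minus_eq)
qed

text \<open>
  The difference of two first entries that have been corrected by \<open>s e c\<close> and \<open>- s' e c\<close>, where
  \<open>c = w - v + 1\<close>, is \<open>1\<close> up to multiples of \<open>k'\<close> and \<open>k\<close>: modulo these \<open>e\<close> and \<open>s + s'\<close> are both \<open>1\<close>.
\<close>

lemma first_entries_identity:
  assumes c: "v \<in> carrier R" "w \<in> carrier R" "s \<in> carrier R" "s' \<in> carrier R"
    "k \<in> carrier R" "e \<in> carrier R" "k' \<in> carrier R"
    and 1: "k \<oplus> s \<oplus> s' = \<one>" and 2: "e \<oplus> k' = \<one>"
  shows "(v \<oplus> s \<otimes> (e \<otimes> (w \<ominus> v \<oplus> \<one>))) \<ominus> (w \<oplus> s' \<otimes> (\<ominus> (e \<otimes> (w \<ominus> v \<oplus> \<one>))))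
      \<oplus> (k' \<otimes> (w \<ominus> v \<oplus> \<one>) \<oplus> k \<otimes> (e \<otimes> (w \<ominus> v \<oplus> \<one>))) = \<one>"
proof -
  define c where "c = w \<ominus> v \<oplus> \<one>"
  have cc: "c \<in> carrier R" using assms by (simp add: c_def)
  have "(v \<oplus> s \<otimes> (e \<otimes> c)) \<ominus> (w \<oplus> s' \<otimes> (\<ominus> (e \<otimes> c))) \<oplus> (k' \<otimes> c \<oplus> k \<otimes> (e \<otimes> c))
      = (v \<ominus> w) \<oplus> ((k \<oplus> s \<oplus> s') \<otimes> (e \<otimes> c) \<oplus> k' \<otimes> c)"
    using assms(1-7) cc by (simp add: minus_eq l_distr minus_add r_minus minus_minus a_ac)
  also have "\<dots> = (v \<ominus> w) \<oplus> (e \<oplus> k') \<otimes> c"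
    using 1 assms(1-7) cc by (simp add: l_distr)
  also have "\<dots> = (v \<ominus> w) \<oplus> (w \<ominus> v \<oplus> \<one>)" using 2 cc by (simp add: c_def)
  also have "\<dots> = \<one>"
  proof -
    have "(v \<ominus> w) \<oplus> (w \<ominus> v \<oplus> \<one>) = (v \<oplus> \<ominus> v) \<oplus> ((w \<oplus> \<ominus> w) \<oplus> \<one>)"
      using assms(1,2) by (simp add: minus_eq a_ac del: r_neg l_neg)
    then show ?thesis using assms(1,2) by (simp add: r_neg)
  qed
  finally show ?thesis unfolding c_def .
qed

text \<open>
  Multiply \<open>V x - W y = 1\<close> by \<open>q - p\<close>.
\<close>

lemma equalize_identity:
  assumes c: "p \<in> carrier R" "q \<in> carrier R" "x \<in> carrier R" "y \<in> carrier R"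
    "V \<in> carrier R" "W \<in> carrier R"
    and 1: "V \<otimes> x \<ominus> W \<otimes> y = \<one>"
  shows "p \<oplus> V \<otimes> (x \<otimes> (q \<ominus> p)) = q \<oplus> W \<otimes> (y \<otimes> (q \<ominus> p))"
proof -
  define r where "r = q \<ominus> p"
  have r: "r \<in> carrier R" "p \<oplus> r = q"
    using c a_lcomm[of p q "\<ominus> p"] by (simp_all add: r_def minus_eq r_neg)
  have "V \<otimes> x = \<one> \<oplus> W \<otimes> y"
  proof -
    have "V \<otimes> x = (V \<otimes> x \<ominus> W \<otimes> y) \<oplus> W \<otimes> y"
      using c by (simp add: minus_eq a_assoc l_neg)
    then show ?thesis using 1 by simp
  qed
  then have "V \<otimes> x \<otimes> r = (\<one> \<oplus> W \<otimes> y) \<otimes> r" by simp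
  then have "p \<oplus> V \<otimes> (x \<otimes> r) = (p \<oplus> r) \<oplus> W \<otimes> (y \<otimes> r)"
    using c r(1) by (simp add: l_distr m_assoc a_assoc)
  then show ?thesis using r by (simp add: r_def)
qed

section \<open>The relative Mennicke--Newman lemma\<close>

text \<open>
  The three steps described at the beginning, with \<open>v'\<close>, \<open>w'\<close> for the rows after the first one,
  \<open>v'(1 := V)\<close>, \<open>w'(1 := W)\<close> after the second and \<open>v3\<close>, \<open>w3\<close> after the third.
\<close>

lemma relative_mennicke_newman:
  fixes C :: "nat \<Rightarrow> 'a set set"
  assumes I: "ideal I R"
    and cover: "max_spec R = V_max R I \<union> (\<Union>i<m. C i)"
    and disj: "\<forall>i<m. V_max R I \<inter> C i = {}"
    and cl: "\<forall>i<m. closedin (zariski R) (C i)"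
    and irr: "\<forall>i<m. irreducible_space (subtopology (zariski R) (C i))"
    and noeth: "\<forall>i<m. noetherian_space (subtopology (zariski R) (C i))"
    and dim: "\<forall>i<m. top_dim (subtopology (zariski R) (C i)) \<le> enat d"
    and d: "d \<le> 2 * n - 3" and n: "n \<ge> 3"
    and v: "v \<in> Um_rel R n I" and w: "w \<in> Um_rel R n I"
  shows "\<exists>v'\<in>rel_orbit n I v. \<exists>w'\<in>rel_orbit n I w. \<forall>j\<in>{2..n}. v' j = w' j"
proof -
  interpret I: ideal I R by (rule I)
  have n1: "n \<ge> 1" and one_in: "1 \<in> {1..n}" using n by auto
  note v = Um_rel_entries[OF v I.is_ideal n1]
  note w = Um_rel_entries[OF w I.is_ideal n1]
  have in1: "i \<in> {1..n}" if "i \<in> {2..n}" for i using that by auto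
  have v1: "v 1 \<in> carrier R" and w1: "w 1 \<in> carrier R" using v(3) w(3) one_in by blast+

  have "closedin (zariski R) (\<Union>i\<in>{..<m}. C i)"
    using cl by (intro closedin_Union) auto
  then obtain K where K: "ideal K R" and CK: "(\<Union>i<m. C i) = V_max R K"
    unfolding closedin_zariski by blast
  interpret K: ideal K R by (rule K)
  have C_iff: "M \<in> (\<Union>i<m. C i) \<longleftrightarrow> maximalideal M R \<and> K \<subseteq> M" for M
    unfolding CK V_max_def max_spec_def by blast
  have either: "I \<subseteq> M \<or> K \<subseteq> M" if "maximalideal M R" for M
    using cover that unfolding CK V_max_def max_spec_def by blast
  have not_both: False if "maximalideal M R" "I \<subseteq> M" "K \<subseteq> M" for M
  proof -
    have "M \<in> V_max R I" "M \<in> (\<Union>i<m. C i)" using that C_iff by (auto simp: V_max_def max_spec_def)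
    then show False using disj by blast
  qed
  obtain e k\<^sub>0 where e: "e \<in> I" "k\<^sub>0 \<in> K" "e \<oplus> k\<^sub>0 = \<one>"
    by (rule comaximal_ideals[OF I.is_ideal K not_both])
  have ec: "e \<in> carrier R" and k0c: "k\<^sub>0 \<in> carrier R" using e I.Icarr K.Icarr by auto
  have e_notin: "e \<notin> M" if "maximalideal M R" "K \<subseteq> M" for M
  proof
    assume "e \<in> M"
    then have "e \<oplus> k\<^sub>0 \<in> M"
      using that e(2) by (meson additive_subgroup.a_closed ideal.axioms(1) maximalideal.axioms(1) subsetD)
    then show False using e(3) maximalideal_one_notin[OF that(1)] by simp
  qed

  \<comment> \<open>The first component of an index in \<open>S\<close> tells the two rows apart, so that
    general position applies to the entries of both at once.\<close>
  define S where "S = (UNIV :: bool set) \<times> {2..n}"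
  define a where "a = (\<lambda>(c, i). if c then v i else w i)"
  define b where "b = v 1 \<otimes> w 1 \<otimes> e"
  have b: "b \<in> carrier R" using v1 w1 ec by (simp add: b_def)
  have S: "finite S" and cardS: "d < card S"
    using d n by (simp_all add: S_def card_cartesian_product)
  have a: "a \<in> S \<rightarrow> carrier R" using v(3) w(3) in1 by (auto simp: a_def S_def)
  have unimod: "\<exists>s\<in>S. a s \<notin> M" if M: "M \<in> (\<Union>i<m. C i)" "b \<in> M" for M
  proof -
    have mM: "maximalideal M R" "K \<subseteq> M" using M(1) C_iff by auto
    interpret P: primeideal M R using mM(1) by (rule maximalideal_prime)
    have "v 1 \<in> M \<or> w 1 \<in> M"
      using P.I_prime[of "v 1 \<otimes> w 1" e] P.I_prime[of "v 1" "w 1"] M(2) e_notin[OF mM] v1 w1 ec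
      unfolding b_def by auto
    moreover have "\<exists>i\<in>{2..n}. u i \<notin> M" if u: "u \<in> Um R n" "u 1 \<in> M" for u
    proof -
      obtain i where "i \<in> {1..n}" "u i \<notin> M" using Um_not_in_maximalideal[OF u(1) mM(1)] by (elim bexE) (rule that)
      moreover from this u(2) have "i \<noteq> 1" by metis
      ultimately show ?thesis by (intro bexI[of _ i]) auto
    qed
    ultimately consider i where "i \<in> {2..n}" "v i \<notin> M" | i where "i \<in> {2..n}" "w i \<notin> M"
      using v(1) w(1) by blast
    then show ?thesis
    proof cases
      case 1
      then show ?thesis by (intro bexI[of _ "(True, i)"]) (auto simp: a_def S_def)
    next
      case 2
      then show ?thesis by (intro bexI[of _ "(False, i)"]) (auto simp: a_def S_def)
    qed
  qed
  have "\<exists>t\<in>S \<rightarrow> carrier R. \<forall>M\<in>(\<Union>i<m. C i). \<exists>s\<in>S. a s \<oplus> b \<otimes> t s \<notin> M"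
    by (rule stable_range[OF S a b cl irr noeth dim cardS]) (rule unimod)
  then obtain t where t: "t \<in> S \<rightarrow> carrier R"
    and avoid: "\<forall>M\<in>(\<Union>i<m. C i). \<exists>s\<in>S. a s \<oplus> b \<otimes> t s \<notin> M"
    by (elim bexE) (rule that)
  have tc: "t (c, i) \<in> carrier R" if "i \<in> {2..n}" for c i using t that by (auto simp: S_def)

  define v' where "v' = (\<lambda>j. if j \<in> {2..n} then v j \<oplus> v 1 \<otimes> (w 1 \<otimes> e \<otimes> t (True, j)) else v j)"
  define w' where "w' = (\<lambda>j. if j \<in> {2..n} then w j \<oplus> w 1 \<otimes> (v 1 \<otimes> e \<otimes> t (False, j)) else w j)"
  have in_I: "x \<otimes> e \<otimes> t (c, j) \<in> I" if "x \<in> carrier R" "j \<in> {2..n}" for x c j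
    using that tc e(1) by (intro I.I_r_closed I.I_l_closed) auto
  have v'_orb: "v' \<in> rel_orbit n I v" unfolding v'_def
    using in_I[OF w1] by (intro rel_orbit_add_first_to_others[OF n I.is_ideal v(2) rel_orbit_refl[OF v(2)]]) auto
  have w'_orb: "w' \<in> rel_orbit n I w" unfolding w'_def
    using in_I[OF v1] by (intro rel_orbit_add_first_to_others[OF n I.is_ideal w(2) rel_orbit_refl[OF w(2)]]) auto
  have v'_I: "v' j \<in> I" and w'_I: "w' j \<in> I" if "j \<in> {2..n}" for j
    using that I.a_closed[OF v(5)[OF that] I.I_l_closed[OF in_I[OF w1 that] v1]]
      I.a_closed[OF w(5)[OF that] I.I_l_closed[OF in_I[OF v1 that] w1]]
    by (simp_all add: v'_def w'_def)
  have v'c: "v' \<in> {2..n} \<rightarrow> carrier R" and w'c: "w' \<in> {2..n} \<rightarrow> carrier R"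
    using v'_I w'_I I.Icarr by auto
  have v'1: "v' 1 = v 1" and w'1: "w' 1 = w 1" by (simp_all add: v'_def w'_def)
  have avoid': "\<exists>i\<in>{2..n}. v' i \<notin> M \<or> w' i \<notin> M" if M: "maximalideal M R" "K \<subseteq> M" for M
  proof -
    have "M \<in> (\<Union>i<m. C i)" using C_iff M by simp
    from bspec[OF avoid this] obtain c i where ci: "i \<in> {2..n}" "a (c, i) \<oplus> b \<otimes> t (c, i) \<notin> M"
      unfolding S_def by auto
    have "a (c, i) \<oplus> b \<otimes> t (c, i) = (if c then v' i else w' i)"
      using ci(1) tc[OF ci(1)] v1 w1 ec by (auto simp: a_def b_def v'_def w'_def m_ac)
    then show ?thesis using ci by (intro bexI[of _ i]) (auto split: if_splits)
  qed

  \<comment> \<open>The entries of \<open>v'\<close> and \<open>w'\<close> and the ideal \<open>K\<close>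
    generate the unit ideal: \<open>1 = k + s + s'\<close> with \<open>k \<in> K\<close>.\<close>
  obtain J where J: "ideal J R" "K \<subseteq> J" "v' ` {2..n} \<subseteq> J"
    and J_elem: "\<forall>z\<in>J. \<exists>j\<in>K. \<exists>p\<in>{2..n} \<rightarrow> carrier R. z = j \<oplus> (\<Oplus>i\<in>{2..n}. v' i \<otimes> p i)"
    using finite_row_ideal[OF finite_atLeastAtMost K v'c] by (elim exE conjE) (rule that)
  obtain L where L: "ideal L R" "J \<subseteq> L" "w' ` {2..n} \<subseteq> L"
    and L_elem: "\<forall>z\<in>L. \<exists>j\<in>J. \<exists>p\<in>{2..n} \<rightarrow> carrier R. z = j \<oplus> (\<Oplus>i\<in>{2..n}. w' i \<otimes> p i)"
    using finite_row_ideal[OF finite_atLeastAtMost J(1) w'c] by (elim exE conjE) (rule that)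
  have "\<one> \<in> L"
  proof (rule ccontr)
    assume "\<one> \<notin> L"
    then obtain M where M: "maximalideal M R" "L \<subseteq> M"
      by (rule proper_ideal_subset_maximalideal[OF L(1)])
    then have KM: "K \<subseteq> M" and vM: "v' ` {2..n} \<subseteq> M" and wM: "w' ` {2..n} \<subseteq> M"
      using J(2,3) L(2,3) by (metis subset_trans)+
    obtain i where "i \<in> {2..n}" "v' i \<notin> M \<or> w' i \<notin> M"
      using avoid'[OF M(1) KM] by (elim bexE) (rule that)
    then show False using vM wM unfolding image_subset_iff by simp
  qed
  obtain j q where j: "j \<in> J" and q: "q \<in> {2..n} \<rightarrow> carrier R"
    and one_j: "\<one> = j \<oplus> (\<Oplus>i\<in>{2..n}. w' i \<otimes> q i)"
    using bspec[OF L_elem \<open>\<one> \<in> L\<close>] by (elim bexE) (rule that)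
  obtain k p where k: "k \<in> K" and p: "p \<in> {2..n} \<rightarrow> carrier R"
    and j_k: "j = k \<oplus> (\<Oplus>i\<in>{2..n}. v' i \<otimes> p i)"
    using bspec[OF J_elem j] by (elim bexE) (rule that)
  define s where "s = (\<Oplus>i\<in>{2..n}. v' i \<otimes> p i)"
  define s' where "s' = (\<Oplus>i\<in>{2..n}. w' i \<otimes> q i)"
  have vp: "(\<lambda>i. v' i \<otimes> p i) \<in> {2..n} \<rightarrow> carrier R"
    and wq: "(\<lambda>i. w' i \<otimes> q i) \<in> {2..n} \<rightarrow> carrier R"
    using v'c w'c p q by (simp_all add: Pi_iff)
  have sc: "s \<in> carrier R" "s' \<in> carrier R" and kc: "k \<in> carrier R"
    using vp wq k K.Icarr by (auto simp: s_def s'_def intro!: finsum_closed)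
  have one_ks: "k \<oplus> s \<oplus> s' = \<one>" using one_j j_k by (simp add: s_def s'_def)

  define c where "c = w 1 \<ominus> v 1 \<oplus> \<one>"
  have cc: "c \<in> carrier R" using v1 w1 by (simp add: c_def)
  \<comment> \<open>By the choice of \<open>c\<close>, the corrections \<open>s e c\<close> and \<open>- s' e
    c\<close> make the difference of the first entries \<open>\<equiv> 1\<close> modulo \<open>K\<close>; the
    factor \<open>e\<close> puts the coefficients into \<open>I\<close>.\<close>
  define V where "V = v 1 \<oplus> s \<otimes> (e \<otimes> c)"
  define W where "W = w 1 \<oplus> s' \<otimes> (\<ominus> (e \<otimes> c))"
  have VW: "V \<in> carrier R" "W \<in> carrier R" using v1 w1 sc ec cc by (simp_all add: V_def W_def)
  have pI: "p i \<otimes> (e \<otimes> c) \<in> I" and qI: "q i \<otimes> (\<ominus> (e \<otimes> c)) \<in> I" if "i \<in> {2..n}" for i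
  proof -
    have "p i \<in> carrier R" "q i \<in> carrier R" using that p q by auto
    moreover have "e \<otimes> c \<in> I" using e(1) cc by (rule I.I_r_closed)
    ultimately show "p i \<otimes> (e \<otimes> c) \<in> I" "q i \<otimes> (\<ominus> (e \<otimes> c)) \<in> I"
      by (simp_all add: I.I_l_closed I.a_inv_closed)
  qed
  have "v'(1 := v' 1 \<oplus> (\<Oplus>i\<in>{2..n}. v' i \<otimes> (p i \<otimes> (e \<otimes> c)))) \<in> rel_orbit n I v"
    using pI by (intro rel_orbit_add_others_to_first[OF n I.is_ideal v(2) v'_orb]) auto
  moreover have "(\<Oplus>i\<in>{2..n}. v' i \<otimes> (p i \<otimes> (e \<otimes> c))) = s \<otimes> (e \<otimes> c)"
    unfolding s_def using v'c p ec cc vp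
    by (subst finsum_ldistr) (auto simp: Pi_iff m_assoc intro!: finsum_cong')
  ultimately have v''_orb: "v'(1 := V) \<in> rel_orbit n I v" unfolding V_def v'1 by (simp only:)
  have "w'(1 := w' 1 \<oplus> (\<Oplus>i\<in>{2..n}. w' i \<otimes> (q i \<otimes> (\<ominus> (e \<otimes> c))))) \<in> rel_orbit n I w"
    using qI by (intro rel_orbit_add_others_to_first[OF n I.is_ideal w(2) w'_orb]) auto
  moreover have "(\<Oplus>i\<in>{2..n}. w' i \<otimes> (q i \<otimes> (\<ominus> (e \<otimes> c)))) = s' \<otimes> (\<ominus> (e \<otimes> c))"
    unfolding s'_def using w'c q ec cc wq
    by (subst finsum_ldistr) (auto simp: Pi_iff m_assoc intro!: finsum_cong')
  ultimately have w''_orb: "w'(1 := W) \<in> rel_orbit n I w" unfolding W_def w'1 by (simp only:)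

  have comax: False if M: "maximalideal M R" "V \<in> M" "W \<in> M" for M
  proof -
    interpret M: maximalideal M R by (rule M(1))
    from either[OF M(1)] have "\<one> \<in> M"
    proof
      assume "I \<subseteq> M"
      then have "s \<otimes> (e \<otimes> c) \<in> M" "v 1 \<ominus> \<one> \<in> M"
        using M.I_l_closed[OF M.I_r_closed[OF _ cc] sc(1)] e(1) v(4) by blast+
      then have "V \<ominus> s \<otimes> (e \<otimes> c) \<ominus> (v 1 \<ominus> \<one>) \<in> M"
        using M(2) M.a_closed M.a_inv_closed by (simp add: minus_eq)
      moreover have "V \<ominus> s \<otimes> (e \<otimes> c) \<ominus> (v 1 \<ominus> \<one>) = \<one>"
        unfolding V_def using v1 sc ec cc
        by (simp add: minus_eq minus_add minus_minus a_assoc r_neg r_neg1 r_neg2)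
      ultimately show ?thesis by simp
    next
      assume KM: "K \<subseteq> M"
      have "V \<ominus> W \<oplus> (k\<^sub>0 \<otimes> c \<oplus> k \<otimes> (e \<otimes> c)) \<in> M"
        using KM M(2,3) e(2) k cc ec
        by (simp add: minus_eq M.a_closed M.a_inv_closed M.I_r_closed subset_iff)
      then show ?thesis
        using first_entries_identity[OF v1 w1 sc kc ec k0c one_ks e(3)] by (simp only: V_def W_def c_def)
    qed
    then show False using maximalideal_one_notin[OF M(1)] by simp
  qed
  obtain x y where x: "x \<in> carrier R" and y: "y \<in> carrier R" and VxWy: "V \<otimes> x \<ominus> W \<otimes> y = \<one>"
    by (rule comaximal_elements[OF VW comax])

  \<comment> \<open>The entries of \<open>w'\<close> and \<open>v'\<close> beyond the first differ by elements
    of \<open>I\<close>, which the operations of this step need as coefficients.\<close>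
  define v3 where "v3 = (\<lambda>j. if j \<in> {2..n} then (v'(1 := V)) j \<oplus> (v'(1 := V)) 1 \<otimes> (x \<otimes> (w' j \<ominus> v' j)) else (v'(1 := V)) j)"
  define w3 where "w3 = (\<lambda>j. if j \<in> {2..n} then (w'(1 := W)) j \<oplus> (w'(1 := W)) 1 \<otimes> (y \<otimes> (w' j \<ominus> v' j)) else (w'(1 := W)) j)"
  have diff_I: "w' j \<ominus> v' j \<in> I" if "j \<in> {2..n}" for j
    using v'_I w'_I that by (auto simp: minus_eq intro!: I.a_closed I.a_inv_closed)
  have v3_orb: "v3 \<in> rel_orbit n I v" unfolding v3_def
    using diff_I x by (intro rel_orbit_add_first_to_others[OF n I.is_ideal v(2) v''_orb]) (auto intro!: I.I_l_closed)
  have w3_orb: "w3 \<in> rel_orbit n I w" unfolding w3_def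
    using diff_I y by (intro rel_orbit_add_first_to_others[OF n I.is_ideal w(2) w''_orb]) (auto intro!: I.I_l_closed)
  have eq: "v3 j = w3 j" if "j \<in> {2..n}" for j
  proof -
    have "v' j \<in> carrier R" "w' j \<in> carrier R" using that v'c w'c by auto
    from equalize_identity[OF this x y VW VxWy] show ?thesis using that by (simp add: v3_def w3_def)
  qed
  show ?thesis using v3_orb w3_orb eq by blast
qed

end

theorem lemma7p4:
  fixes R :: "('a, 'b) ring_scheme"
    and I :: "'a set"
    and n d m :: nat
    and C :: "nat \<Rightarrow> 'a set set"
    and v w :: "nat \<Rightarrow> 'a"
  assumes "cring R" and "noetherian_ring R" and "ideal I R"
    and "max_spec R = V_max R I \<union> (\<Union>i<m. C i)"
    and "disjoint_family_on C {..<m}"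
    and "\<forall>i<m. V_max R I \<inter> C i = {}"
    and "\<forall>i<m. closedin (zariski R) (C i)"
    and "\<forall>i<m. irreducible_space (subtopology (zariski R) (C i))"
    and "\<forall>i<m. noetherian_space (subtopology (zariski R) (C i))"
    and "\<forall>i<m. top_dim (subtopology (zariski R) (C i)) \<le> enat d"
    and "d \<le> 2 * n - 3" and "n \<ge> 3"
    and "v \<in> Um_rel R n I" and "w \<in> Um_rel R n I"
  shows "\<exists>\<epsilon>\<^sub>1\<in>E_rel R n I. \<exists>\<epsilon>\<^sub>2\<in>E_rel R n I.
           \<exists>a\<in>carrier R. \<exists>b\<in>carrier R. \<exists>c\<in>{2..n} \<rightarrow> carrier R.
             row_mult R n v \<epsilon>\<^sub>1 = (\<lambda>j\<in>{1..n}. if j = 1 then a else c j) \<and>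
             row_mult R n w \<epsilon>\<^sub>2 = (\<lambda>j\<in>{1..n}. if j = 1 then b else c j)"
proof -
  interpret cring R by fact
  have v: "v \<in> rows R n" and w: "w \<in> rows R n"
    using assms(13,14) unfolding Um_rel_def Um_def by auto
  obtain v3 w3 where v3_orb: "v3 \<in> rel_orbit n I v" and w3_orb: "w3 \<in> rel_orbit n I w"
    and eq: "\<forall>j\<in>{2..n}. v3 j = w3 j"
    using relative_mennicke_newman[OF assms(3,4,6-14)] by (elim bexE) (rule that)
  have v3r: "v3 \<in> rows R n" and w3r: "w3 \<in> rows R n"
    using rel_orbit_rows v w v3_orb w3_orb by blast+
  obtain \<epsilon>\<^sub>1 where \<epsilon>1: "\<epsilon>\<^sub>1 \<in> E_rel R n I" "row_mult R n v \<epsilon>\<^sub>1 = v3"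
    using v3_orb unfolding rel_orbit_def by blast
  obtain \<epsilon>\<^sub>2 where \<epsilon>2: "\<epsilon>\<^sub>2 \<in> E_rel R n I" "row_mult R n w \<epsilon>\<^sub>2 = w3"
    using w3_orb unfolding rel_orbit_def by blast
  have c1: "v3 1 \<in> carrier R" "w3 1 \<in> carrier R" and c2: "v3 \<in> {2..n} \<rightarrow> carrier R"
    using v3r w3r \<open>n \<ge> 3\<close> unfolding rows_def by auto
  have r1: "v3 = (\<lambda>j\<in>{1..n}. if j = 1 then v3 1 else v3 j)"
    using v3r unfolding rows_def by (auto simp: fun_eq_iff restrict_def PiE_def extensional_def)
  have r2: "w3 = (\<lambda>j\<in>{1..n}. if j = 1 then w3 1 else v3 j)"
  proof
    fix j
    show "w3 j = (\<lambda>j\<in>{1..n}. if j = 1 then w3 1 else v3 j) j"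
      using w3r bspec[OF eq, of j] unfolding rows_def by (auto simp: restrict_def PiE_def extensional_def)
  qed
  show ?thesis
    using \<epsilon>1 \<epsilon>2 c1 c2 r1 r2
    by (intro bexI[of _ \<epsilon>\<^sub>1] bexI[of _ \<epsilon>\<^sub>2] bexI[of _ "v3 1"] bexI[of _ "w3 1"] bexI[of _ v3]) auto
qed

end
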